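(* Let $\beta \in (0,1)$ be fixed, set $\varepsilon_n = n^{-\beta}$, and let $(\sigma_n)$ be a sequence of positive numbers. Consider, as $n \to \infty$, the problem of testing, based on $X_1,\dots,X_n$, the null hypothesis $\mathcal{H}_0$ that $X_1,\dots,X_n$ are iid $\mathcal{N}(0,1)$ versus the alternative $\mathcal{H}_1$ that $X_1,\dots,X_n$ are iid from the mixture $(1-\varepsilon_n)\,\mathcal{N}(0,1) + \varepsilon_n\,\mathcal{N}(0,\sigma_n^2)$. The higher criticism test is asymptotically powerful in each of the following cases: (i) $\sigma_n = n^{-\gamma}$ with $\gamma > 0$ fixed and $\gamma > 2\beta - 1$; (ii) $|\sigma_n - 1| = n^{-\gamma}$ with $\gamma > 0$ fixed and $\gamma < 1/2 - \beta$; (iii) $\sigma_n = \sigma$ is fixed with $\sigma > 1/\sqrt{1-\beta}$; (iv) $\beta < 1/2$ and $\sigma_n = \sigma \ne 1$ is fixed.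
   Context: $\mathcal{N}(0,s^2)$ denotes the centered Gaussian distribution on $\mathbb{R}$ with variance $s^2$. The asymptotic regime is $n \to \infty$, and only $n$ large enough that $\varepsilon_n < 1/2$ is considered. The higher criticism test rejects $\mathcal{H}_0$ for large values of $$H = \sup_{x \ge 0} \frac{\sqrt{n}\,|F_n(x) - \Psi(x)|}{\sqrt{\Psi(x)(1-\Psi(x))}},$$ where $\Psi(x) = 2\Phi(x) - 1$, $\Phi$ is the standard normal distribution function, and $F_n(x) = \frac1n \sum_{i=1}^n \mathbb{I}\{|X_i| \le x\}$ (at $x = 0$, where almost surely the ratio is $0/0$, it is read as $0$); i.e., it has rejection region $\{H \ge h_n\}$ for some critical value $h_n$. The critical value may depend on $n$ but not on $(\beta, \gamma, \sigma)$. The risk of a test is the sum of its probabilities of Type I error (rejecting under $\mathcal{H}_0$) and Type II error (not rejecting under $\mathcal{H}_1$). The higher criticism test is said to be asymptotically powerful if, for some choice of critical values $(h_n)$, its risk tends to $0$ as $n\to\infty$. *)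

theory Defs
  imports "HOL-Probability.Probability"
begin

definition gaussian :: "real \<Rightarrow> real measure"
  where "gaussian s = density lborel (\<lambda>x. ennreal (normal_density 0 s x))"

definition gaussian_mixture :: "real \<Rightarrow> real \<Rightarrow> real measure"
  where "gaussian_mixture e s =
    density lborel (\<lambda>x. ennreal ((1 - e) * normal_density 0 1 x + e * normal_density 0 s x))"

definition iid :: "nat \<Rightarrow> real measure \<Rightarrow> (nat \<Rightarrow> real) measure"
  where "iid n M = Pi\<^sub>M {..<n} (\<lambda>_. M)"

definition Phi :: "real \<Rightarrow> real"
  where "Phi x = cdf (gaussian 1) x"

definition Psi :: "real \<Rightarrow> real"
  where "Psi x = 2 * Phi x - 1"

definition emp_cdf :: "nat \<Rightarrow> (nat \<Rightarrow> real) \<Rightarrow> real \<Rightarrow> real"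
  where "emp_cdf n X x = (1 / real n) * (\<Sum>i<n. of_bool (\<bar>X i\<bar> \<le> x))"

text \<open>At \<open>x = 0\<close> the denominator vanishes, and division by zero gives the ratio the value
  \<open>0\<close>. The supremum is taken in the extended reals because it is infinite on the null event
  that some observation equals \<open>0\<close>.\<close>

definition hc_stat :: "nat \<Rightarrow> (nat \<Rightarrow> real) \<Rightarrow> ereal"
  where "hc_stat n X =
    (SUP x\<in>{0..}. ereal (sqrt (real n) * \<bar>emp_cdf n X x - Psi x\<bar> / sqrt (Psi x * (1 - Psi x))))"

definition eps :: "real \<Rightarrow> nat \<Rightarrow> real"
  where "eps \<beta> n = real n powr (- \<beta>)"

text \<open>The condition \<open>n \<ge> 1\<close> is needed because \<open>0 powr a = 0\<close>.\<close>

definition regime :: "real \<Rightarrow> nat set"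
  where "regime \<beta> = {n. 1 \<le> n \<and> eps \<beta> n < 1 / 2}"

definition hc_risk :: "nat \<Rightarrow> real \<Rightarrow> real \<Rightarrow> real \<Rightarrow> real"
  where "hc_risk n h e s =
    (let P0 = iid n (gaussian 1); P1 = iid n (gaussian_mixture e s)
     in measure P0 {X \<in> space P0. hc_stat n X \<ge> ereal h} +
        measure P1 {X \<in> space P1. \<not> hc_stat n X \<ge> ereal h})"

definition hc_powerful :: "(nat \<Rightarrow> real) \<Rightarrow> real \<Rightarrow> (nat \<Rightarrow> real) \<Rightarrow> bool"
  where "hc_powerful h \<beta> \<sigma> \<longleftrightarrow> (\<lambda>n. hc_risk n (h n) (eps \<beta> n) (\<sigma> n)) \<longlonglongrightarrow> 0"

text \<open>The mixture given by its density is the mixture of the two laws.\<close>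

lemma emeasure_gaussian_mixture:
  assumes "0 \<le> e" "e \<le> 1" "A \<in> sets borel"
  shows "emeasure (gaussian_mixture e s) A =
    ennreal (1 - e) * emeasure (gaussian 1) A + ennreal e * emeasure (gaussian s) A"
proof -
  have "emeasure (gaussian_mixture e s) A =
    (\<integral>\<^sup>+x. ennreal (1 - e) * (ennreal (normal_density 0 1 x) * indicator A x) +
       ennreal e * (ennreal (normal_density 0 s x) * indicator A x) \<partial>lborel)"
    unfolding gaussian_mixture_def using assms
    by (subst emeasure_density)
       (auto intro!: nn_integral_cong split: split_indicator simp: ennreal_mult ennreal_plus)
  also have "\<dots> = ennreal (1 - e) * emeasure (gaussian 1) A + ennreal e * emeasure (gaussian s) A"
    unfolding gaussian_def using assms
    by (simp add: nn_integral_add nn_integral_cmult emeasure_density)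
  finally show ?thesis .
qed

lemma prob_space_gaussian: "0 < s \<Longrightarrow> prob_space (gaussian s)"
  unfolding gaussian_def by (rule prob_space_normal_density)

lemma prob_space_gaussian_mixture:
  assumes "0 \<le> e" "e \<le> 1" "0 < s"
  shows "prob_space (gaussian_mixture e s)"
proof
  have "emeasure (gaussian t) UNIV = 1" if "0 < t" for t
    using prob_space.emeasure_space_1[OF prob_space_gaussian[OF that]] by (simp add: gaussian_def)
  then show "emeasure (gaussian_mixture e s) (space (gaussian_mixture e s)) = 1"
    using assms emeasure_gaussian_mixture[OF assms(1,2), of UNIV s]
    by (simp add: gaussian_mixture_def flip: ennreal_plus)
qed

lemma continuous_Psi: "continuous_on UNIV Psi"
proof -
  interpret prob_space "gaussian 1" by (rule prob_space_gaussian) simp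
  interpret real_distribution "gaussian 1"
    by unfold_locales (auto simp: gaussian_def)
  have "measure (gaussian 1) {x} = 0" for x
    unfolding gaussian_def measure_def
    by (subst emeasure_density) (auto simp: nn_integral_cong_AE nn_integral_0_iff_AE AE_lborel_singleton
        intro!: arg_cong[where f=enn2real] split: split_indicator)
  then have "isCont (cdf (gaussian 1)) x" for x
    by (simp add: isCont_cdf)
  then show ?thesis
    unfolding Psi_def Phi_def by (auto intro!: continuous_intros simp: continuous_on_eq_continuous_at)
qed

text \<open>The events whose probabilities enter the risk are measurable.\<close>

lemma measurable_hc_stat:
  assumes sets_M: "sets M = sets borel"
  shows "hc_stat n \<in> borel_measurable (iid n M)"
proof -
  define D where "D x = sqrt (Psi x * (1 - Psi x))" for x
  define R where "R X x = sqrt (real n) * \<bar>emp_cdf n X x - Psi x\<bar> / D x" for X x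
  have hc: "hc_stat n X = (SUP x\<in>{0..}. ereal (R X x))" for X
    by (simp add: hc_stat_def R_def D_def)
  have Psi_lim: "(Psi \<longlongrightarrow> Psi x) (at_right x)" for x
    using continuous_Psi continuous_on_eq_continuous_at[of UNIV Psi]
    by (auto simp: isCont_def intro: filterlim_at_split[THEN iffD1, THEN conjunct2])
  have emp_lim: "((\<lambda>y. emp_cdf n X y) \<longlongrightarrow> emp_cdf n X x) (at_right x)" for X x
  proof -
    have "((\<lambda>y. of_bool (\<bar>X i\<bar> \<le> y)) \<longlongrightarrow> (of_bool (\<bar>X i\<bar> \<le> x) :: real)) (at_right x)" for i
    proof (rule tendsto_eventually, cases "\<bar>X i\<bar> \<le> x")
      case True
      then show "\<forall>\<^sub>F y in at_right x. of_bool (\<bar>X i\<bar> \<le> y) = (of_bool (\<bar>X i\<bar> \<le> x) :: real)"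
        unfolding eventually_at_right_field by (intro exI[of _ "x + 1"]) auto
    next
      case False
      then show "\<forall>\<^sub>F y in at_right x. of_bool (\<bar>X i\<bar> \<le> y) = (of_bool (\<bar>X i\<bar> \<le> x) :: real)"
        unfolding eventually_at_right_field by (intro exI[of _ "\<bar>X i\<bar>"]) auto
    qed
    then show ?thesis
      unfolding emp_cdf_def by (intro tendsto_intros)
  qed
  have R_lim: "((\<lambda>y. R X y) \<longlongrightarrow> R X x) (at_right x)" if "D x \<noteq> 0" for X x
    using that unfolding R_def D_def by (intro tendsto_intros emp_lim Psi_lim) auto
  define Z where "Z = (if \<exists>x\<ge>0. D x = 0 then {SOME x. 0 \<le> x \<and> D x = 0} else {})"
  define A where "A = (\<rat> \<inter> {0..}) \<union> Z"
  have Z: "z \<ge> 0 \<and> D z = 0" if "z \<in> Z" for z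
    using that someI_ex[of "\<lambda>x. 0 \<le> x \<and> D x = 0"] by (auto simp: Z_def split: if_splits)
  have Z_ne: "Z \<noteq> {}" if "0 \<le> x" "D x = 0" for x
    using that by (auto simp: Z_def)
  have "countable Z" by (simp add: Z_def)
  then have count_A: "countable A"
    unfolding A_def by (intro countable_Un countable_Int1 countable_rat)
  have hc_A: "hc_stat n X = (SUP x\<in>A. ereal (R X x))" for X
    unfolding hc
  proof (rule antisym)
    show "(SUP x\<in>A. ereal (R X x)) \<le> (SUP x\<in>{0..}. ereal (R X x))"
      using Z by (intro SUP_subset_mono) (auto simp: A_def)
    show "(SUP x\<in>{0..}. ereal (R X x)) \<le> (SUP x\<in>A. ereal (R X x))"
    proof (rule SUP_least)
      fix x :: real
      assume "x \<in> {0..}"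
      then have x: "0 \<le> x" by simp
      show "ereal (R X x) \<le> (SUP x\<in>A. ereal (R X x))"
      proof (cases "D x = 0")
        case True
        then obtain z where z: "z \<in> Z" using Z_ne x by blast
        then have "ereal (R X x) = ereal (R X z)"
          using True Z by (simp add: R_def)
        also have "\<dots> \<le> (SUP x\<in>A. ereal (R X x))"
          using z by (intro SUP_upper) (auto simp: A_def)
        finally show ?thesis .
      next
        case False
        show ?thesis
        proof (rule ccontr)
          assume "\<not> ?thesis"
          then have "(SUP x\<in>A. ereal (R X x)) < ereal (R X x)" by simp
          moreover have "((\<lambda>y. ereal (R X y)) \<longlongrightarrow> ereal (R X x)) (at_right x)"
            using R_lim[OF False] by simp
          ultimately have "\<forall>\<^sub>F y in at_right x. (SUP x\<in>A. ereal (R X x)) < ereal (R X y)"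
            by (rule order_tendstoD(1)[rotated])
          then obtain b where b: "x < b"
            and gt: "\<And>y. x < y \<Longrightarrow> y < b \<Longrightarrow> (SUP x\<in>A. ereal (R X x)) < ereal (R X y)"
            unfolding eventually_at_right_field by blast
          obtain q where q: "q \<in> \<rat>" "x < q" "q < b"
            using Rats_dense_in_real[OF b] by blast
          then have "ereal (R X q) \<le> (SUP x\<in>A. ereal (R X x))"
            using x by (intro SUP_upper) (auto simp: A_def)
          with gt[OF q(2,3)] show False by simp
        qed
      qed
    qed
  qed
  have coord: "(\<lambda>X. X i) \<in> borel_measurable (iid n M)" if "i < n" for i
  proof -
    have "(\<lambda>X. X i) \<in> measurable (iid n M) M"
      unfolding iid_def using that by (intro measurable_component_singleton) simp
    then show ?thesis
      by (simp add: measurable_cong_sets[OF refl sets_M])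
  qed
  have "(\<lambda>X. R X x) \<in> borel_measurable (iid n M)" for x
  proof -
    have "(\<lambda>X. of_bool (\<bar>X i\<bar> \<le> x) :: real) \<in> borel_measurable (iid n M)" if "i < n" for i
    proof -
      have "(\<lambda>t::real. of_bool (\<bar>t\<bar> \<le> x) :: real) \<in> borel_measurable borel"
        by measurable
      from measurable_compose[OF coord[OF that] this] show ?thesis .
    qed
    then have "(\<lambda>X. emp_cdf n X x) \<in> borel_measurable (iid n M)"
      unfolding emp_cdf_def by (intro borel_measurable_times borel_measurable_sum) auto
    then show ?thesis unfolding R_def by measurable
  qed
  then have "(\<lambda>X. SUP x\<in>A. ereal (R X x)) \<in> borel_measurable (iid n M)"
    by (intro borel_measurable_SUP count_A borel_measurable_ereal)
  then show ?thesis
    using hc_A by (simp cong: measurable_cong)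
qed

end

theory Submission
  imports Defs "HOL-Real_Asymp.Real_Asymp"
begin

text \<open>
  For a symmetric interval \<open>{- x..x}\<close> the empirical distribution function of the absolute values is
  a binomial count divided by \<open>n\<close>, and the higher criticism statistic is the largest deviation of
  these counts from their null means, in units of their null standard deviations. The critical value
  is \<open>(ln n)\<^sup>2\<close>: all power conditions leave a factor that is a positive power of \<open>n\<close>, so logarithmic
  factors are harmless on both sides.

  Both errors are controlled by one concentration bound, \<open>hits_concentration\<close>: a binomial count
  deviates from its mean by \<open>L\<close> times the larger of \<open>1\<close> and its standard deviation with probability
  at most \<open>2 * exp (1 - L)\<close>. It follows from Chernoff's method.

  Under the null hypothesis (\<open>hc_type_I_le\<close>) the bound is applied with \<open>L\<close> of order \<open>ln n\<close> at the
  points where \<open>Psi\<close> is a multiple of \<open>1 / n\<close>. Counts and means are monotone in \<open>x\<close>, and means change by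
  \<open>1\<close> between neighbours, so this controls the whole supremum except where the null variance is
  almost zero. In these extreme ranges there is no observation, with probability tending to one, and
  then the ratio is bounded.

  Under the alternative (\<open>hc_type_II_le\<close>) the statistic is at least its value at a single threshold
  \<open>x\<close>. There the mean of the count is shifted by \<open>n * eps \<beta> n * (Psi (x / \<sigma> n) - Psi x)\<close>, and the
  test detects the shift when its absolute value is large, and also large compared with the null
  standard deviation (\<open>hc_powerfulI\<close>). Each case then only needs a threshold: \<open>x = \<sigma> n\<close> for a shrinking
  component (\<open>hc_powerful_shrinking\<close>), \<open>x = 1\<close> for \<open>\<beta> < 1 / 2\<close> (\<open>hc_powerful_dense\<close>), and
  \<open>x = sqrt (2 * r * ln n)\<close> with a suitable \<open>r\<close> for a wide component (\<open>hc_powerful_fixed_sparse\<close>).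
\<close>

section \<open>Concentration of binomial counts\<close>

text \<open>For negative \<open>x\<close> the bound is obtained by inverting the lower Taylor bound
  \<open>1 + y + y\<^sup>2 / 2 \<le> exp y\<close> at \<open>y = - x\<close>. Having it on both sides of \<open>0\<close> matters because a centred
  indicator takes both signs.\<close>

lemma exp_le_quadratic:
  fixes x :: real
  assumes "\<bar>x\<bar> \<le> 1"
  shows "exp x \<le> 1 + x + x\<^sup>2"
proof (cases "0 \<le> x")
  case True
  then show ?thesis using assms by (intro exp_bound) auto
next
  case False
  define y where "y = - x"
  have y: "0 \<le> y" using False by (simp add: y_def)
  have "1 \<le> (1 + y + y\<^sup>2 / 2) * (1 - y + y\<^sup>2)"
  proof -
    have "(1 + y + y\<^sup>2 / 2) * (1 - y + y\<^sup>2) = 1 + (y\<^sup>2 + y ^ 3 + y ^ 4) / 2"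
      by (simp add: field_simps power2_eq_square power3_eq_cube power4_eq_xxxx)
    then show ?thesis using y by simp
  qed
  also have "\<dots> \<le> exp y * (1 - y + y\<^sup>2)"
  proof (rule mult_right_mono[OF exp_lower_Taylor_quadratic[OF y]])
    have "0 \<le> (1 - y)\<^sup>2 + y" using y by simp
    then show "0 \<le> 1 - y + y\<^sup>2" using y by (simp add: power2_eq_square algebra_simps)
  qed
  finally show ?thesis
    by (simp add: y_def exp_minus field_simps)
qed

definition hits :: "nat \<Rightarrow> real set \<Rightarrow> (nat \<Rightarrow> real) \<Rightarrow> real"
  where "hits n A X = (\<Sum>i<n. indicator A (X i))"

lemma emp_cdf_eq_hits: "emp_cdf n X x = hits n {- x..x} X / real n"
proof -
  have "(of_bool (\<bar>X i\<bar> \<le> x) :: real) = indicator {- x..x} (X i)" for i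
    by (auto simp: indicator_def)
  then show ?thesis by (simp add: emp_cdf_def hits_def)
qed

text \<open>Passing to the complement turns upper deviations into lower ones, keeping the variance.\<close>

lemma hits_Compl: "hits n (- A) X = real n - hits n A X"
proof -
  have "indicator (- A) (X i) = (1 :: real) - indicator A (X i)" for i
    by (simp add: indicator_def)
  then show ?thesis by (simp add: hits_def sum_subtractf)
qed

lemma hits_mono: "A \<subseteq> B \<Longrightarrow> hits n A X \<le> hits n B X"
  unfolding hits_def by (intro sum_mono) (auto simp: indicator_def)

lemma hits_nonneg: "0 \<le> hits n A X"
  unfolding hits_def by (intro sum_nonneg) auto

lemma hits_le: "hits n A X \<le> real n"
  using hits_nonneg[of n "- A" X] by (simp add: hits_Compl)

context real_distribution
begin

lemma prob_space_iid: "prob_space (iid n M)"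
  unfolding iid_def by (intro prob_space_PiM prob_space_axioms)

lemma coordinate_measurable: "i < n \<Longrightarrow> (\<lambda>X. X i) \<in> borel_measurable (iid n M)"
proof -
  assume "i < n"
  then have "(\<lambda>X. X i) \<in> measurable (iid n M) M"
    unfolding iid_def by (intro measurable_component_singleton) simp
  then show ?thesis by (simp add: measurable_cong_sets[OF refl events_eq_borel])
qed

lemma hits_measurable:
  assumes "A \<in> sets borel"
  shows "hits n A \<in> borel_measurable (iid n M)"
proof -
  have "(\<lambda>X. indicator A (X i) :: real) \<in> borel_measurable (iid n M)" if "i < n" for i
    using measurable_compose[OF coordinate_measurable[OF that] borel_measurable_indicator[OF assms]] .
  then show ?thesis
    unfolding hits_def by (intro borel_measurable_sum) auto
qed

text \<open>Averaging the quadratic bound of \<open>exp\<close> kills the linear term, because the indicator is centred;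
  what remains is the variance \<open>p * (1 - p)\<close>. Keeping the variance, where a bound such as Hoeffding's
  would keep only the range, is what makes the later tail bounds scale like the denominator of the
  higher criticism ratio, also near \<open>p = 0\<close> and \<open>p = 1\<close>.\<close>

lemma indicator_mgf:
  assumes A: "A \<in> sets borel" and \<theta>: "0 \<le> \<theta>" "\<theta> \<le> 1"
  shows "(\<integral>\<^sup>+x. ennreal (exp (\<theta> * (indicator A x - prob A))) \<partial>M)
     \<le> ennreal (exp (\<theta>\<^sup>2 * (prob A * (1 - prob A))))"
proof -
  define p where "p = prob A"
  have p: "0 \<le> p" "p \<le> 1" by (auto simp: p_def)
  have q: "prob (- A) = 1 - p"
    using prob_compl[of A] A by (simp add: p_def Compl_eq_Diff_UNIV)
  have le1: "\<theta> * (1 - p) \<le> 1" "\<theta> * p \<le> 1"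
    using \<theta> p by (auto intro!: mult_le_one)
  have "(\<integral>\<^sup>+x. ennreal (exp (\<theta> * (indicator A x - p))) \<partial>M)
     = (\<integral>\<^sup>+x. ennreal (exp (\<theta> * (1 - p))) * indicator A x
          + ennreal (exp (- \<theta> * p)) * indicator (- A) x \<partial>M)"
    by (intro nn_integral_cong) (auto simp: indicator_def)
  also have "\<dots> = ennreal (exp (\<theta> * (1 - p))) * emeasure M A + ennreal (exp (- \<theta> * p)) * emeasure M (- A)"
    using A by (simp add: nn_integral_add nn_integral_cmult_indicator)
  also have "\<dots> = ennreal (exp (\<theta> * (1 - p)) * p + exp (- \<theta> * p) * (1 - p))"
    using p by (simp add: emeasure_eq_measure q ennreal_mult flip: p_def)
  also have "\<dots> \<le> ennreal (exp (\<theta>\<^sup>2 * (p * (1 - p))))"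
  proof (rule ennreal_leI)
    have "exp (\<theta> * (1 - p)) * p + exp (- \<theta> * p) * (1 - p)
      \<le> (1 + \<theta> * (1 - p) + (\<theta> * (1 - p))\<^sup>2) * p + (1 + (- \<theta> * p) + (- \<theta> * p)\<^sup>2) * (1 - p)"
      using p \<theta> le1 by (intro add_mono mult_right_mono exp_le_quadratic) auto
    also have "\<dots> = 1 + \<theta>\<^sup>2 * (p * (1 - p))"
      by (simp add: power2_eq_square algebra_simps)
    also have "\<dots> \<le> exp (\<theta>\<^sup>2 * (p * (1 - p)))" by (rule exp_ge_add_one_self)
    finally show "exp (\<theta> * (1 - p)) * p + exp (- \<theta> * p) * (1 - p) \<le> exp (\<theta>\<^sup>2 * (p * (1 - p)))" .
  qed
  finally show ?thesis by (simp add: p_def)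
qed

text \<open>A Chernoff bound. The parameter \<open>\<theta>\<close> is the inverse of the scale
  \<open>w = max 1 (sqrt (n * p * (1 - p)))\<close>: then \<open>\<theta> \<le> 1\<close>, as the bound on the moment generating function
  demands, the exponent \<open>n * \<theta>\<^sup>2 * p * (1 - p)\<close> is at most \<open>1\<close>, and a deviation by \<open>L\<close> scales has
  probability of order \<open>exp (- L)\<close>. The lower cutoff \<open>1\<close> of the scale reflects the Poisson regime, in which the
  fluctuations are of order one.\<close>

lemma hits_upper_tail:
  assumes A: "A \<in> sets borel"
  shows "measure (iid n M) {X \<in> space (iid n M).
      L * max 1 (sqrt (real n * (prob A * (1 - prob A)))) \<le> hits n A X - real n * prob A} \<le> exp (1 - L)"
proof -
  interpret P: prob_space "iid n M" by (rule prob_space_iid)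
  interpret product_sigma_finite "\<lambda>_::nat. M"
    by unfold_locales
  define p where "p = prob A"
  define w where "w = max 1 (sqrt (real n * (p * (1 - p))))"
  have w: "1 \<le> w" by (simp add: w_def)
  have nv: "0 \<le> real n * (p * (1 - p))" by (simp add: p_def)
  have w2: "real n * (p * (1 - p)) \<le> w\<^sup>2"
  proof -
    have "(sqrt (real n * (p * (1 - p))))\<^sup>2 \<le> w\<^sup>2"
      using nv by (intro power_mono) (auto simp: w_def)
    then show ?thesis using nv by simp
  qed
  define \<theta> where "\<theta> = 1 / w"
  have \<theta>: "0 < \<theta>" "\<theta> \<le> 1" using w by (auto simp: \<theta>_def)
  note [measurable] = hits_measurable[OF A]
  have "emeasure (iid n M) {X \<in> space (iid n M). L * w \<le> hits n A X - real n * p}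
     \<le> ennreal (exp (- \<theta> * (L * w))) *
        (\<integral>\<^sup>+X. ennreal (exp (\<theta> * (hits n A X - real n * p))) * indicator (space (iid n M)) X \<partial>iid n M)"
    by (intro Chernoff_ineq_nn_integral_ge \<theta>) auto
  also have "(\<integral>\<^sup>+X. ennreal (exp (\<theta> * (hits n A X - real n * p))) * indicator (space (iid n M)) X \<partial>iid n M)
     = (\<integral>\<^sup>+X. (\<Prod>i<n. ennreal (exp (\<theta> * (indicator A (X i) - p)))) \<partial>iid n M)"
    by (intro nn_integral_cong)
       (simp add: hits_def prod_ennreal flip: exp_sum sum_distrib_left, simp add: sum_subtractf)
  also have "\<dots> = (\<Prod>i<n. \<integral>\<^sup>+x. ennreal (exp (\<theta> * (indicator A x - p))) \<partial>M)"
    unfolding iid_def using A by (intro product_nn_integral_prod) auto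
  also have "\<dots> \<le> (\<Prod>i<n. ennreal (exp (\<theta>\<^sup>2 * (p * (1 - p)))))"
    unfolding p_def using \<theta> indicator_mgf[OF A] by (intro prod_mono_ennreal) auto
  also have "\<dots> = ennreal (exp (real n * (\<theta>\<^sup>2 * (p * (1 - p)))))"
    by (simp add: ennreal_power exp_of_nat_mult)
  also have "\<dots> \<le> ennreal (exp 1)"
  proof -
    have "real n * (\<theta>\<^sup>2 * (p * (1 - p))) = (real n * (p * (1 - p))) / w\<^sup>2"
      by (simp add: \<theta>_def power_divide)
    also have "\<dots> \<le> 1" using w2 w by (simp add: divide_le_eq)
    finally show ?thesis by (intro ennreal_leI) simp
  qed
  also have "ennreal (exp (- \<theta> * (L * w))) * ennreal (exp 1) = ennreal (exp (1 - L))"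
    using w by (simp add: \<theta>_def exp_diff exp_minus field_simps flip: ennreal_mult)
  finally have "emeasure (iid n M) {X \<in> space (iid n M). L * w \<le> hits n A X - real n * p}
     \<le> ennreal (exp (1 - L))" by (simp add: mult_left_mono)
  then show ?thesis
    by (simp add: P.emeasure_eq_measure w_def p_def)
qed

lemma hits_concentration:
  assumes A: "A \<in> sets borel"
  shows "measure (iid n M) {X \<in> space (iid n M).
      L * max 1 (sqrt (real n * (prob A * (1 - prob A)))) \<le> \<bar>hits n A X - real n * prob A\<bar>} \<le> 2 * exp (1 - L)"
proof -
  interpret P: prob_space "iid n M" by (rule prob_space_iid)
  define w where "w = L * max 1 (sqrt (real n * (prob A * (1 - prob A))))"
  have q: "prob (- A) = 1 - prob A"
    using prob_compl[of A] A by (simp add: Compl_eq_Diff_UNIV)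
  note [measurable] = hits_measurable[OF A]
  let ?U = "{X \<in> space (iid n M). w \<le> hits n A X - real n * prob A}"
  let ?D = "{X \<in> space (iid n M). w \<le> real n * prob A - hits n A X}"
  have "hits n (- A) X - real n * prob (- A) = real n * prob A - hits n A X" for X
    by (simp add: hits_Compl q algebra_simps)
  then have D: "P.prob ?D \<le> exp (1 - L)"
    using hits_upper_tail[of "- A" n L] A by (simp add: q w_def mult.commute)
  have "{X \<in> space (iid n M). w \<le> \<bar>hits n A X - real n * prob A\<bar>} = ?U \<union> ?D"
    by (auto simp: abs_if split: if_splits)
  then have "P.prob {X \<in> space (iid n M). w \<le> \<bar>hits n A X - real n * prob A\<bar>} \<le> P.prob ?U + P.prob ?D"
    by (auto intro!: measure_Un_le)
  also have "\<dots> \<le> 2 * exp (1 - L)"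
    using D hits_upper_tail[OF A, of n L] by (simp add: w_def)
  finally show ?thesis by (simp add: w_def)
qed

lemma prob_some_hit:
  assumes A: "A \<in> sets borel"
  shows "measure (iid n M) {X \<in> space (iid n M). hits n A X \<noteq> 0} \<le> real n * prob A"
proof -
  interpret P: prob_space "iid n M" by (rule prob_space_iid)
  have m: "{X \<in> space (iid n M). X i \<in> A} \<in> sets (iid n M)" if "i < n" for i
    using coordinate_measurable[OF that] A by measurable
  have "P.prob {X \<in> space (iid n M). X i \<in> A} = prob A" if "i < n" for i
  proof -
    have "distr (iid n M) M (\<lambda>X. X i) = M"
      unfolding iid_def using that prob_space_axioms by (intro distr_PiM_component) auto
    then have "prob A = measure (distr (iid n M) M (\<lambda>X. X i)) A" by simp
    also have "\<dots> = P.prob {X \<in> space (iid n M). X i \<in> A}"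
      using A coordinate_measurable[OF that]
      by (subst measure_distr) (auto simp: measurable_cong_sets[OF refl events_eq_borel] intro!: arg_cong[where f=P.prob])
    finally show ?thesis by simp
  qed note single = this
  have "P.prob {X \<in> space (iid n M). hits n A X \<noteq> 0} \<le> P.prob (\<Union>i<n. {X \<in> space (iid n M). X i \<in> A})"
    using m by (intro P.finite_measure_mono) (auto simp: hits_def indicator_def dest!: sum.not_neutral_contains_not_neutral split: if_splits)
  also have "\<dots> \<le> (\<Sum>i<n. P.prob {X \<in> space (iid n M). X i \<in> A})"
    using m by (intro P.finite_measure_subadditive_finite) auto
  also have "\<dots> = real n * prob A" by (simp add: single)
  finally show ?thesis .
qed

end

section \<open>The distribution function of the absolute value of a Gaussian\<close>

lemma emeasure_gaussian:
  "A \<in> sets borel \<Longrightarrow> emeasure (gaussian s) A = (\<integral>\<^sup>+x. ennreal (normal_density 0 s x) * indicator A x \<partial>lborel)"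
  unfolding gaussian_def by (subst emeasure_density) auto

lemma sets_gaussian [simp]: "sets (gaussian s) = sets borel"
  by (simp add: gaussian_def)

lemma space_gaussian [simp]: "space (gaussian s) = UNIV"
  by (simp add: gaussian_def)

lemma measure_gaussian_reflect:
  "measure (gaussian s) {..<- x} = measure (gaussian s) {x<..}"
proof -
  have "emeasure (gaussian s) {..<- x} = emeasure (gaussian s) {x<..}"
    unfolding emeasure_gaussian[OF lessThan_borel] emeasure_gaussian[OF greaterThan_borel]
    by (subst nn_integral_real_affine[where c="- 1" and t=0])
       (auto intro!: nn_integral_cong simp: normal_density_def indicator_def)
  then show ?thesis by (simp add: measure_def)
qed

lemma measure_gaussian_scale:
  assumes "0 < s"
  shows "measure (gaussian s) {- x..x} = measure (gaussian 1) {- (x / s)..x / s}"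
proof -
  have *: "ennreal s * (ennreal (normal_density 0 s (s * u)) * indicator {- x..x} (s * u))
      = ennreal (normal_density 0 1 u) * indicator {- (x / s)..x / s} u" for u
  proof -
    have "s * normal_density 0 s (s * u) = normal_density 0 1 u"
      using assms by (simp add: normal_density_def real_sqrt_mult power_mult_distrib)
    then show ?thesis
      using assms by (auto simp: indicator_def field_simps simp flip: ennreal_mult)
  qed
  have "emeasure (gaussian s) {- x..x} = emeasure (gaussian 1) {- (x / s)..x / s}"
    using assms unfolding emeasure_gaussian[OF atLeastAtMost_borel]
    by (subst nn_integral_real_affine[where c=s and t=0])
       (auto simp: nn_integral_cmult[symmetric] * simp del: ennreal_mult)
  then show ?thesis by (simp add: measure_def)
qed

lemma real_distribution_gaussian: "0 < s \<Longrightarrow> real_distribution (gaussian s)"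
  by (intro real_distribution.intro prob_space_gaussian real_distribution_axioms.intro) simp_all

interpretation std_gaussian: real_distribution "gaussian 1"
  by (rule real_distribution_gaussian) simp

text \<open>By symmetry of the normal law the two tails outside \<open>{- x..x}\<close> have equal mass.\<close>

lemma Psi_eq_measure:
  assumes "0 \<le> x"
  shows "Psi x = measure (gaussian 1) {- x..x}"
proof -
  have "{..x} = {..<- x} \<union> {- x..x}" using assms by auto
  then have "Phi x = measure (gaussian 1) ({..<- x} \<union> {- x..x})"
    by (simp add: Phi_def cdf_def)
  also have "\<dots> = measure (gaussian 1) {..<- x} + measure (gaussian 1) {- x..x}"
    by (intro std_gaussian.finite_measure_Union) auto
  also have "measure (gaussian 1) {..<- x} = 1 - Phi x"
  proof -
    have "measure (gaussian 1) (UNIV - {..x}) = 1 - measure (gaussian 1) {..x}"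
      using std_gaussian.prob_compl[of "{..x}"] by simp
    then show ?thesis
      by (simp add: measure_gaussian_reflect Phi_def cdf_def Compl_eq_Diff_UNIV[symmetric])
  qed
  finally show ?thesis by (simp add: Psi_def)
qed

lemma measure_gaussian_eq_Psi:
  "0 < s \<Longrightarrow> 0 \<le> x \<Longrightarrow> measure (gaussian s) {- x..x} = Psi (x / s)"
  by (subst measure_gaussian_scale) (simp_all add: Psi_eq_measure)

lemma Psi_0 [simp]: "Psi 0 = 0"
proof -
  have "emeasure (gaussian 1) {0} = (\<integral>\<^sup>+u. ennreal (std_normal_density 0) * indicator {0 :: real} u \<partial>lborel)"
    unfolding emeasure_gaussian[OF borel_singleton[OF sets.empty_sets]]
    by (intro nn_integral_cong) (simp add: indicator_def)
  also have "\<dots> = 0" by (simp add: nn_integral_cmult_indicator)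
  finally have "measure (gaussian 1) {0} = 0" by (simp only: measure_def enn2real_0)
  then show ?thesis by (simp only: Psi_eq_measure[OF order_refl] minus_zero atLeastAtMost_singleton)
qed

lemma Psi_diff: "x \<le> y \<Longrightarrow> Psi y - Psi x = 2 * measure (gaussian 1) {x<..y}"
  using std_gaussian.cdf_diff_eq[of x y] by (cases "x = y") (simp_all add: Psi_def Phi_def)

lemma std_normal_density_antimono:
  "0 \<le> x \<Longrightarrow> x \<le> y \<Longrightarrow> std_normal_density y \<le> std_normal_density x"
  by (simp add: std_normal_density_def divide_right_mono power_mono)

text \<open>On the positive half-line the density decreases, so increments of \<open>Psi\<close> are squeezed between
  the end point values of twice the density, times the length. These two bounds stand in for
  the derivative of \<open>Psi\<close>.\<close>

lemma Psi_diff_le: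
  assumes "0 \<le> x" "x \<le> y"
  shows "Psi y - Psi x \<le> 2 * std_normal_density x * (y - x)"
proof -
  have "emeasure (gaussian 1) {x<..y} \<le> (\<integral>\<^sup>+u. ennreal (std_normal_density x) * indicator {x<..y} u \<partial>lborel)"
    using assms by (subst emeasure_gaussian)
      (auto intro!: nn_integral_mono ennreal_leI std_normal_density_antimono simp: indicator_def)
  also have "\<dots> = ennreal (std_normal_density x * (y - x))"
    using assms by (simp add: nn_integral_cmult_indicator ennreal_mult)
  finally have "measure (gaussian 1) {x<..y} \<le> std_normal_density x * (y - x)"
    using assms by (simp add: std_gaussian.emeasure_eq_measure)
  then show ?thesis using assms by (simp add: Psi_diff)
qed

lemma Psi_diff_ge:
  assumes "0 \<le> x" "x \<le> y"
  shows "2 * std_normal_density y * (y - x) \<le> Psi y - Psi x"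
proof -
  have "ennreal (std_normal_density y * (y - x)) = (\<integral>\<^sup>+u. ennreal (std_normal_density y) * indicator {x<..y} u \<partial>lborel)"
    using assms by (simp add: nn_integral_cmult_indicator ennreal_mult)
  also have "\<dots> \<le> emeasure (gaussian 1) {x<..y}"
    using assms by (subst emeasure_gaussian)
      (auto intro!: nn_integral_mono ennreal_leI std_normal_density_antimono simp: indicator_def)
  finally have "std_normal_density y * (y - x) \<le> measure (gaussian 1) {x<..y}"
    using assms by (simp add: std_gaussian.emeasure_eq_measure)
  then show ?thesis using assms by (simp add: Psi_diff)
qed

lemma Psi_strict_mono: "0 \<le> x \<Longrightarrow> x < y \<Longrightarrow> Psi x < Psi y"
  using Psi_diff_ge[of x y] normal_density_pos[of 1 0 y] by (smt (verit) mult_pos_pos)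

lemma Psi_mono: "x \<le> y \<Longrightarrow> Psi x \<le> Psi y"
  using Psi_diff[of x y] by (smt (verit) measure_nonneg)

lemma Psi_le_1: "Psi x \<le> 1"
  using std_gaussian.cdf_bounded_prob[of x] by (simp add: Psi_def Phi_def)

lemma Psi_less_1: "0 \<le> x \<Longrightarrow> Psi x < 1"
  using Psi_strict_mono[of x "x + 1"] Psi_le_1[of "x + 1"] by simp

lemma Psi_nonneg: "0 \<le> x \<Longrightarrow> 0 \<le> Psi x"
  using Psi_mono[of 0 x] by simp

lemma Psi_pos: "0 < x \<Longrightarrow> 0 < Psi x"
  using Psi_strict_mono[of 0 x] by simp

lemma Psi_less_iff: "0 \<le> x \<Longrightarrow> 0 \<le> y \<Longrightarrow> Psi x < Psi y \<longleftrightarrow> x < y"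
  using Psi_strict_mono[of x y] Psi_mono[of y x] by linarith

lemma Psi_tendsto_1: "(Psi \<longlongrightarrow> 1) at_top"
proof -
  have "(Phi \<longlongrightarrow> 1) at_top"
    using std_gaussian.cdf_lim_at_top_prob by (simp add: Phi_def[abs_def])
  then have "((\<lambda>x. 2 * Phi x - 1) \<longlongrightarrow> 2 * 1 - 1) at_top"
    by (intro tendsto_intros)
  then show ?thesis by (simp add: Psi_def[abs_def])
qed

lemma Psi_surj:
  assumes "0 \<le> t" "t < 1"
  obtains x where "0 \<le> x" "Psi x = t"
proof -
  have "\<forall>\<^sub>F x in at_top. t < Psi x"
    using Psi_tendsto_1 assms(2) by (rule order_tendstoD)
  then have "\<forall>\<^sub>F x in at_top. t < Psi x \<and> 0 \<le> x"
    using eventually_ge_at_top[of 0] by eventually_elim simp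
  then obtain b where "t < Psi b" "0 \<le> b"
    using eventually_happens'[OF trivial_limit_at_top_linorder] by blast
  then have "\<exists>x\<ge>0. x \<le> b \<and> Psi x = t"
    using assms continuous_Psi by (intro IVT') (auto intro: continuous_on_subset)
  then show ?thesis using that by blast
qed

lemma Psi_le_self: "0 \<le> x \<Longrightarrow> Psi x \<le> x"
proof -
  assume x: "0 \<le> x"
  have "2 * std_normal_density 0 \<le> 1"
  proof -
    have "2 \<le> sqrt (2 * pi)" using pi_gt3 by (intro real_le_rsqrt) simp
    then show ?thesis by (simp add: std_normal_density_def field_simps)
  qed
  then have "2 * std_normal_density 0 * x \<le> 1 * x" using x by (intro mult_right_mono)
  then show ?thesis using Psi_diff_le[of 0 x] x by simp
qed

text \<open>Beyond \<open>x \<ge> 1\<close> the density \<open>\<phi> u\<close> is dominated by \<open>u * \<phi> u\<close>, which has the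
  antiderivative \<open>- \<phi> u\<close>.\<close>

lemma Psi_upper_tail_le:
  assumes "1 \<le> x"
  shows "1 - Psi x \<le> 2 * std_normal_density x"
proof -
  have "Psi y \<le> Psi x + 2 * std_normal_density x" if "x \<le> y" for y
  proof -
    let ?F = "\<lambda>u. - std_normal_density u" and ?f = "\<lambda>u. u * std_normal_density u"
    have "emeasure (gaussian 1) {x<..y} \<le> (\<integral>\<^sup>+u. ennreal (?f u) * indicator {x..y} u \<partial>lborel)"
    proof (subst emeasure_gaussian, simp, intro nn_integral_mono)
      fix u :: real
      have "1 * std_normal_density u \<le> u * std_normal_density u" if "x < u"
        using that assms by (intro mult_right_mono) auto
      then show "ennreal (std_normal_density u) * indicator {x<..y} u \<le> ennreal (?f u) * indicator {x..y} u"
        by (auto simp: indicator_def intro!: ennreal_leI)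
    qed
    also have "\<dots> = ?F y - ?F x"
    proof (rule nn_integral_FTC_Icc[OF _ _ _ that])
      have "((\<lambda>u. - (c * exp (- u\<^sup>2 / 2))) has_real_derivative u * (c * exp (- u\<^sup>2 / 2))) (at u)" for c u :: real
        by (auto intro!: derivative_eq_intros)
      then show "(?F has_real_derivative ?f u) (at u)" for u
        unfolding std_normal_density_def[abs_def] .
    qed (use assms in auto)
    also have "\<dots> \<le> ennreal (std_normal_density x)"
      using normal_density_nonneg[of 0 1 y] by (intro ennreal_leI) simp
    finally have "emeasure (gaussian 1) {x<..y} \<le> ennreal (std_normal_density x)" .
    then have "measure (gaussian 1) {x<..y} \<le> std_normal_density x"
      by (simp add: std_gaussian.emeasure_eq_measure)
    then show ?thesis using Psi_diff[OF that] by simp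
  qed
  then have "\<forall>\<^sub>F y in at_top. Psi y \<le> Psi x + 2 * std_normal_density x"
    unfolding eventually_at_top_linorder by blast
  from tendsto_upperbound[OF Psi_tendsto_1 this] show ?thesis by simp
qed

text \<open>The mass of \<open>{x<..x + 1}\<close> alone suffices. For \<open>x \<ge> 1\<close> the loss against the true tail
  is a factor of at most \<open>exp (x + 1 / 2)\<close>, which at \<open>x\<close> of order \<open>sqrt (ln n)\<close> grows more slowly than
  any positive power of \<open>n\<close>.\<close>

lemma Psi_upper_tail_ge:
  assumes "0 \<le> x"
  shows "2 * std_normal_density (x + 1) \<le> 1 - Psi x"
  using Psi_diff_ge[of x "x + 1"] Psi_le_1[of "x + 1"] assms by simp

section \<open>Type I error\<close>

text \<open>Multiplying the ratio through by \<open>n\<close> standardizes the binomial count \<open>hits n {- x..x}\<close>.\<close>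

lemma hc_term_eq:
  assumes "1 \<le> n"
  shows "sqrt (real n) * \<bar>emp_cdf n X x - Psi x\<bar> / sqrt (Psi x * (1 - Psi x))
    = \<bar>hits n {- x..x} X - real n * Psi x\<bar> / sqrt (real n * (Psi x * (1 - Psi x)))"
proof -
  have "emp_cdf n X x - Psi x = (hits n {- x..x} X - real n * Psi x) / real n"
    using assms by (simp add: emp_cdf_eq_hits field_simps)
  then have "sqrt (real n) * \<bar>emp_cdf n X x - Psi x\<bar>
      = \<bar>hits n {- x..x} X - real n * Psi x\<bar> * (sqrt (real n) / real n)"
    by simp
  also have "sqrt (real n) / real n = 1 / sqrt (real n)"
    using assms by (simp add: field_simps)
  finally have "sqrt (real n) * \<bar>emp_cdf n X x - Psi x\<bar>
      = \<bar>hits n {- x..x} X - real n * Psi x\<bar> / sqrt (real n)" by simp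
  then show ?thesis by (simp add: real_sqrt_mult)
qed

lemma bernoulli_variance_lipschitz:
  fixes s t :: real
  assumes "0 \<le> s" "s \<le> 1" "0 \<le> t" "t \<le> 1"
  shows "s * (1 - s) \<le> t * (1 - t) + \<bar>s - t\<bar>"
proof -
  have "s * (1 - s) - t * (1 - t) = (s - t) * (1 - s - t)" by (simp add: algebra_simps)
  also have "\<dots> \<le> \<bar>s - t\<bar> * \<bar>1 - s - t\<bar>" by (metis abs_ge_self abs_mult)
  also have "\<dots> \<le> \<bar>s - t\<bar> * 1" using assms by (intro mult_left_mono) auto
  finally show ?thesis by simp
qed

lemma max_1_sqrt_le: "u \<le> v + 1 \<Longrightarrow> 0 \<le> v \<Longrightarrow> max 1 (sqrt u) \<le> sqrt (v + 1)"
  by simp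

text \<open>A deterministic bound on the supremum in terms of finitely many counts. At the points \<open>y k\<close>,
  where \<open>Psi\<close> equals \<open>k / n\<close>, both the count and its null mean are controlled; between two
  neighbours both are monotone and the mean moves by \<open>1\<close>, so the deviation is at most
  \<open>L * sqrt (v + 1) + 1\<close>, where \<open>v\<close> is the null variance of the count. This is comparable to \<open>sqrt v\<close>
  as soon as \<open>v \<ge> \<delta> / 2\<close>, that is, for \<open>Psi x\<close> between \<open>\<delta> / n\<close> and \<open>1 - \<delta> / n\<close>. Outside this range a
  single observation can make the ratio arbitrarily large, which is why it is assumed that no
  observation falls there; then the count is \<open>0\<close> or \<open>n\<close> and the ratio is bounded.\<close>

lemma hc_stat_le:
  fixes \<delta> L :: real and X :: "nat \<Rightarrow> real"
  assumes n: "2 \<le> n" and \<delta>: "0 < \<delta>" "\<delta> \<le> 1" and L: "0 \<le> L"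
  assumes ab: "0 \<le> a" "Psi a = \<delta> / real n" "0 \<le> b" "Psi b = 1 - \<delta> / real n"
  assumes y: "\<And>k. k \<in> {1..<n} \<Longrightarrow> 0 \<le> y k" "\<And>k. k \<in> {1..<n} \<Longrightarrow> Psi (y k) = real k / real n"
  assumes grid: "\<And>k. k \<in> {1..<n} \<Longrightarrow> \<bar>hits n {- y k..y k} X - real k\<bar>
      < L * max 1 (sqrt (real n * (Psi (y k) * (1 - Psi (y k)))))"
  assumes none_below: "hits n {- a..a} X = 0" and none_above: "hits n (- {- b..b}) X = 0"
  shows "hc_stat n X \<le> ereal ((L + 1) * sqrt (1 + 2 / \<delta>))"
  unfolding hc_stat_def
proof (rule SUP_least)
  fix x :: real assume "x \<in> {0..}"
  then have x: "0 \<le> x" by simp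
  define C where "C = (L + 1) * sqrt (1 + 2 / \<delta>)"
  define t where "t = Psi x"
  define v where "v = real n * (t * (1 - t))"
  define S where "S = hits n {- x..x} X"
  have t: "0 \<le> t" "t < 1" using Psi_nonneg[OF x] Psi_less_1[OF x] by (auto simp: t_def)
  have v: "0 \<le> v" using t by (simp add: v_def)
  have C0: "0 \<le> C" using L \<delta> by (simp add: C_def)
  have \<delta>n: "\<delta> / real n \<le> 1 / 2" using n \<delta> by (simp add: field_simps)
  have C2: "2 \<le> C\<^sup>2"
  proof -
    have "1 * 2 \<le> (L + 1)\<^sup>2 * (1 + 2 / \<delta>)"
      using L \<delta> by (intro mult_mono) (auto simp: field_simps)
    then show ?thesis using \<delta> by (simp add: C_def power_mult_distrib)
  qed
  have "\<bar>S - real n * t\<bar> \<le> C * sqrt v"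
  proof -
    consider "t \<le> \<delta> / n" | "1 - \<delta> / n \<le> t" | "\<delta> / n < t" "t < 1 - \<delta> / n" by linarith
    then show ?thesis
    proof cases
      case 1
      then have "x \<le> a" using Psi_less_iff[OF ab(1) x] ab(2) by (simp add: t_def)
      then have "S \<le> hits n {- a..a} X" unfolding S_def by (intro hits_mono) auto
      then have "S = 0" using none_below hits_nonneg[of n "{- x..x}" X] by (simp add: S_def)
      have nt: "real n * t \<le> 1" using 1 n \<delta> by (simp add: field_simps)
      have "(real n * t)\<^sup>2 \<le> real n * t * 1"
        unfolding power2_eq_square using nt t by (intro mult_left_mono) auto
      also have "\<dots> \<le> real n * t * (2 * (1 - t))"
        using order_trans[OF 1 \<delta>n] t by (intro mult_left_mono) auto
      also have "\<dots> = 2 * v" by (simp add: v_def)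
      also have "\<dots> \<le> C\<^sup>2 * v" using C2 v by (rule mult_right_mono)
      finally have "(real n * t)\<^sup>2 \<le> (C * sqrt v)\<^sup>2" using v by (simp add: power_mult_distrib)
      then show ?thesis using C0 v t \<open>S = 0\<close> by (simp add: abs_mult power2_le_iff_abs_le)
    next
      case 2
      then have "b \<le> x" using Psi_less_iff[OF x ab(3)] ab(4) by (simp add: t_def)
      then have "S = real n"
        using hits_mono[of "{- b..b}" "{- x..x}" n X] hits_le[of n "{- x..x}" X] none_above
        by (simp add: S_def hits_Compl)
      have nt: "real n * (1 - t) \<le> 1" using 2 n \<delta> by (simp add: field_simps)
      have "(real n * (1 - t))\<^sup>2 \<le> real n * (1 - t) * 1"
        unfolding power2_eq_square using nt t by (intro mult_left_mono) auto
      also have "\<dots> \<le> real n * (1 - t) * (2 * t)"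
      proof -
        have "1 / 2 \<le> t" using 2 \<delta>n by linarith
        then show ?thesis using t by (intro mult_left_mono) auto
      qed
      also have "\<dots> = 2 * v" by (simp add: v_def)
      also have "\<dots> \<le> C\<^sup>2 * v" using C2 v by (rule mult_right_mono)
      finally have "(real n * (1 - t))\<^sup>2 \<le> (C * sqrt v)\<^sup>2" using v by (simp add: power_mult_distrib)
      then have "\<bar>real n * (1 - t)\<bar> \<le> C * sqrt v" using C0 v by (simp add: power2_le_iff_abs_le)
      then show ?thesis using \<open>S = real n\<close> by (simp add: algebra_simps)
    next
      case 3
      \<comment> \<open>The grid cell containing \<open>Psi x\<close>; its end points \<open>0\<close> and \<open>n\<close> need no grid point, because
        the count always lies between them.\<close>
      define k where "k = nat \<lfloor>real n * t\<rfloor>"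
      have k: "real k \<le> real n * t" "real n * t < real k + 1"
        using t by (auto simp: k_def)
      have "real n * t < real n" using t n by simp
      then have kn: "k < n" using k by linarith
      define B where "B = L * sqrt (v + 1)"
      have near: "\<bar>hits n {- y j..y j} X - real j\<bar> \<le> B"
        if j: "j \<in> {1..<n}" and close: "\<bar>real j - real n * t\<bar> \<le> 1" for j
      proof -
        let ?s = "real j / real n"
        have "?s * (1 - ?s) \<le> t * (1 - t) + \<bar>?s - t\<bar>"
          using j t by (intro bernoulli_variance_lipschitz) auto
        also have "\<bar>?s - t\<bar> \<le> 1 / real n"
        proof -
          have "?s - t = (real j - real n * t) / real n" using n by (simp add: diff_divide_distrib)
          then have "\<bar>?s - t\<bar> = \<bar>real j - real n * t\<bar> / real n" by simp
          then show ?thesis using close by (simp add: divide_right_mono)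
        qed
        finally have "real n * (?s * (1 - ?s)) \<le> real n * (t * (1 - t) + 1 / real n)"
          by (intro mult_left_mono) auto
        then have "real n * (?s * (1 - ?s)) \<le> v + 1"
          using n by (simp add: v_def distrib_left)
        then have "L * max 1 (sqrt (real n * (?s * (1 - ?s)))) \<le> B"
          unfolding B_def using v L by (intro mult_left_mono max_1_sqrt_le)
        then show ?thesis using grid[OF j] y(2)[OF j] by simp
      qed
      have B: "0 \<le> B" using L v by (simp add: B_def)
      have lower: "real n * t - (B + 1) \<le> S"
      proof (cases "k = 0")
        case True
        then show ?thesis using k B hits_nonneg[of n "{- x..x}" X] by (simp add: S_def)
      next
        case False
        then have j: "k \<in> {1..<n}" using kn by simp
        have "Psi (y k) \<le> t"
          unfolding y(2)[OF j] using k n by (simp add: divide_le_eq mult.commute)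
        then have "y k \<le> x" using Psi_less_iff[OF x y(1)[OF j]] by (simp add: t_def)
        then have "hits n {- y k..y k} X \<le> S" unfolding S_def by (intro hits_mono) auto
        then show ?thesis using near[OF j] k by linarith
      qed
      have upper: "S \<le> real n * t + (B + 1)"
      proof (cases "k + 1 = n")
        case True
        then have "real n = real k + 1" by auto
        then show ?thesis using k B hits_le[of n "{- x..x}" X] by (simp add: S_def)
      next
        case False
        then have j: "k + 1 \<in> {1..<n}" using kn by simp
        have "t \<le> Psi (y (k + 1))"
          unfolding y(2)[OF j] using k n by (simp add: le_divide_eq mult.commute)
        then have "x \<le> y (k + 1)" using Psi_less_iff[OF y(1)[OF j] x] by (simp add: t_def)
        then have "S \<le> hits n {- y (k + 1)..y (k + 1)} X" unfolding S_def by (intro hits_mono) auto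
        then show ?thesis using near[OF j] k by simp
      qed
      \<comment> \<open>One of \<open>t\<close> and \<open>1 - t\<close> is at least \<open>1 / 2\<close>, the other exceeds \<open>\<delta> / n\<close>.\<close>
      have "\<delta> / 2 \<le> v"
      proof -
        have "\<delta> / n * (1 / 2) \<le> t * (1 - t)"
        proof (cases "t \<le> 1 / 2")
          case True
          then show ?thesis using 3 \<delta> t by (intro mult_mono) auto
        next
          case False
          have "\<delta> / n * (1 / 2) \<le> (1 - t) * t" using 3 \<delta> t False by (intro mult_mono) auto
          then show ?thesis by (simp add: mult.commute)
        qed
        then have "real n * (\<delta> / n * (1 / 2)) \<le> v" unfolding v_def by (intro mult_left_mono) auto
        then show ?thesis using n by simp
      qed
      then have "v + 1 \<le> (1 + 2 / \<delta>) * v" using \<delta> by (simp add: field_simps)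
      have "\<bar>S - real n * t\<bar> \<le> B + 1" using lower upper by linarith
      also have "\<dots> \<le> (L + 1) * sqrt (v + 1)" using v by (simp add: B_def algebra_simps)
      also have "\<dots> \<le> (L + 1) * sqrt ((1 + 2 / \<delta>) * v)"
        using L \<open>v + 1 \<le> (1 + 2 / \<delta>) * v\<close> by (intro mult_left_mono real_sqrt_le_mono) auto
      also have "\<dots> = C * sqrt v" by (simp add: C_def real_sqrt_mult)
      finally show ?thesis .
    qed
  qed
  then have "\<bar>S - real n * t\<bar> / sqrt v \<le> C"
    using C0 v by (cases "v = 0") (auto simp: divide_le_eq)
  then show "ereal (sqrt (real n) * \<bar>emp_cdf n X x - Psi x\<bar> / sqrt (Psi x * (1 - Psi x)))
      \<le> ereal ((L + 1) * sqrt (1 + 2 / \<delta>))"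
    using n by (subst hc_term_eq) (auto simp: S_def v_def t_def C_def)
qed

text \<open>A union bound over the grid and the two extreme ranges: each grid point fails with probability
  at most \<open>2 * exp (1 - L)\<close>, and each extreme range has null mass \<open>\<delta> / n\<close>, hence contains one of \<open>n\<close>
  observations with probability at most \<open>\<delta>\<close>.\<close>

lemma hc_type_I_le:
  fixes \<delta> L h :: real
  assumes n: "2 \<le> n" and \<delta>: "0 < \<delta>" "\<delta> \<le> 1" and L: "0 \<le> L"
    and h: "(L + 1) * sqrt (1 + 2 / \<delta>) < h"
  shows "measure (iid n (gaussian 1)) {X \<in> space (iid n (gaussian 1)). ereal h \<le> hc_stat n X}
    \<le> real n * (2 * exp (1 - L)) + 2 * \<delta>"
proof -
  let ?P = "iid n (gaussian 1)"
  interpret P: prob_space ?P by (rule std_gaussian.prob_space_iid)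
  have \<delta>n: "0 < \<delta> / real n" "\<delta> / real n < 1" using n \<delta> by (auto simp: field_simps)
  obtain a where a: "0 \<le> a" "Psi a = \<delta> / real n" using \<delta>n Psi_surj by (metis less_imp_le)
  obtain b where b: "0 \<le> b" "Psi b = 1 - \<delta> / real n" using \<delta>n Psi_surj[of "1 - \<delta> / real n"] by auto
  have "\<exists>x. 0 \<le> x \<and> Psi x = real k / real n" if "k \<in> {1..<n}" for k
    by (rule Psi_surj[of "real k / real n"]) (use that in auto)
  then have "\<forall>k\<in>{1..<n}. \<exists>x. 0 \<le> x \<and> Psi x = real k / real n" by blast
  from bchoice[OF this] obtain y where
    y: "\<And>k. k \<in> {1..<n} \<Longrightarrow> 0 \<le> y k" "\<And>k. k \<in> {1..<n} \<Longrightarrow> Psi (y k) = real k / real n"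
    by blast
  let ?G = "\<lambda>k. {X \<in> space ?P. L * max 1 (sqrt (real n * (Psi (y k) * (1 - Psi (y k)))))
      \<le> \<bar>hits n {- y k..y k} X - real n * Psi (y k)\<bar>}"
  let ?A = "{X \<in> space ?P. hits n {- a..a} X \<noteq> 0}"
  let ?B = "{X \<in> space ?P. hits n (- {- b..b}) X \<noteq> 0}"
  have [measurable]: "hits n A \<in> borel_measurable ?P" if "A \<in> sets borel" for A
    using that by (rule std_gaussian.hits_measurable)
  have sets: "?G k \<in> P.events" "?A \<in> P.events" "?B \<in> P.events" for k
    by measurable
  have G: "P.prob (?G k) \<le> 2 * exp (1 - L)" if "k \<in> {1..<n}" for k
    using std_gaussian.hits_concentration[of "{- y k..y k}" n L] Psi_eq_measure[OF y(1)[OF that]] by simp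
  have A: "P.prob ?A \<le> \<delta>"
    using std_gaussian.prob_some_hit[of "{- a..a}" n] a n by (simp add: Psi_eq_measure[symmetric])
  have B: "P.prob ?B \<le> \<delta>"
  proof -
    have "measure (gaussian 1) (- {- b..b}) = \<delta> / real n"
      using std_gaussian.prob_compl[of "{- b..b}"] b by (simp add: Psi_eq_measure[symmetric] Compl_eq_Diff_UNIV)
    then show ?thesis
      using std_gaussian.prob_some_hit[of "- {- b..b}" n] n by simp
  qed
  have "{X \<in> space ?P. ereal h \<le> hc_stat n X} \<subseteq> (\<Union>k\<in>{1..<n}. ?G k) \<union> (?A \<union> ?B)"
  proof (rule subsetI, rule ccontr)
    fix X assume X: "X \<in> {X \<in> space ?P. ereal h \<le> hc_stat n X}"
      and good: "X \<notin> (\<Union>k\<in>{1..<n}. ?G k) \<union> (?A \<union> ?B)"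
    have "hc_stat n X \<le> ereal ((L + 1) * sqrt (1 + 2 / \<delta>))"
    proof (rule hc_stat_le[OF n \<delta> L a b y])
      fix k assume k: "k \<in> {1..<n}"
      then have nk: "real n * Psi (y k) = real k" using y(2)[OF k] by simp
      have "X \<notin> ?G k" using good k by blast
      then have "\<bar>hits n {- y k..y k} X - real n * Psi (y k)\<bar> < L * max 1 (sqrt (real n * (Psi (y k) * (1 - Psi (y k)))))"
        using X by (simp add: not_le)
      then show "\<bar>hits n {- y k..y k} X - real k\<bar> < L * max 1 (sqrt (real n * (Psi (y k) * (1 - Psi (y k)))))"
        unfolding nk .
    qed (use good X in auto)
    also have "\<dots> < ereal h" using h by simp
    finally show False using X by (simp add: leD)
  qed
  then have "P.prob {X \<in> space ?P. ereal h \<le> hc_stat n X} \<le> P.prob ((\<Union>k\<in>{1..<n}. ?G k) \<union> (?A \<union> ?B))"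
    using sets by (intro P.finite_measure_mono) auto
  also have "\<dots> \<le> P.prob (\<Union>k\<in>{1..<n}. ?G k) + (P.prob ?A + P.prob ?B)"
    using sets by (intro order_trans[OF measure_Un_le] add_mono measure_Un_le order_refl) auto
  also have "P.prob (\<Union>k\<in>{1..<n}. ?G k) \<le> (\<Sum>k\<in>{1..<n}. P.prob (?G k))"
    using sets by (intro P.finite_measure_subadditive_finite) auto
  also have "\<dots> \<le> (\<Sum>k\<in>{1..<n}. 2 * exp (1 - L))" by (intro sum_mono G)
  also have "\<dots> \<le> real n * (2 * exp (1 - L))" by simp
  finally show ?thesis using A B by simp
qed

section \<open>Type II error\<close>

lemma real_distribution_gaussian_mixture:
  "0 \<le> e \<Longrightarrow> e \<le> 1 \<Longrightarrow> 0 < s \<Longrightarrow> real_distribution (gaussian_mixture e s)"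
  by (intro real_distribution.intro prob_space_gaussian_mixture real_distribution_axioms.intro)
     (simp_all add: gaussian_mixture_def)

lemma measure_gaussian_mixture_interval:
  assumes e: "0 \<le> e" "e \<le> 1" and s: "0 < s" and x: "0 \<le> x"
  shows "measure (gaussian_mixture e s) {- x..x} = Psi x + e * (Psi (x / s) - Psi x)"
proof -
  interpret M: real_distribution "gaussian_mixture e s"
    by (rule real_distribution_gaussian_mixture[OF e s])
  interpret S: real_distribution "gaussian s"
    by (rule real_distribution_gaussian[OF s])
  have "ennreal (M.prob {- x..x}) = ennreal ((1 - e) * Psi x + e * Psi (x / s))"
    using emeasure_gaussian_mixture[OF e, of "{- x..x}" s] e s x
    by (simp add: M.emeasure_eq_measure S.emeasure_eq_measure std_gaussian.emeasure_eq_measure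
        measure_gaussian_eq_Psi Psi_eq_measure[symmetric] Psi_nonneg flip: ennreal_mult ennreal_plus)
  moreover have "0 \<le> (1 - e) * Psi x + e * Psi (x / s)"
    using e s x by (simp add: Psi_nonneg)
  ultimately have "M.prob {- x..x} = (1 - e) * Psi x + e * Psi (x / s)" by simp
  then show ?thesis by (simp add: algebra_simps)
qed

text \<open>Under the alternative one well chosen point \<open>x\<close> already makes the statistic large. The mean of
  the count at \<open>x\<close> is shifted by \<open>n * e * (Psi (x / s) - Psi x)\<close>. If its size dominates \<open>h\<close> null
  standard deviations, a small ratio at \<open>x\<close> forces the count to deviate from its true mean by half
  of the shift. The count's variance under the alternative exceeds the null variance by at most the
  shift itself, so a shift of order \<open>h\<^sup>2\<close> also dominates \<open>h\<close> true standard deviations, and the same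
  concentration bound as under the null hypothesis applies.\<close>

lemma hc_type_II_le:
  assumes n: "1 \<le> n" and e: "0 \<le> e" "e \<le> 1" and s: "0 < s" and x: "0 < x" and h: "1 \<le> h"
    and d: "0 \<le> d" "d \<le> e * \<bar>Psi (x / s) - Psi x\<bar>"
    and shift: "8 * h\<^sup>2 \<le> real n * d" "8 * h\<^sup>2 * (Psi x * (1 - Psi x)) \<le> real n * d\<^sup>2"
  shows "measure (iid n (gaussian_mixture e s))
      {X \<in> space (iid n (gaussian_mixture e s)). \<not> ereal h \<le> hc_stat n X} \<le> 2 * exp (1 - h)"
proof -
  interpret M: real_distribution "gaussian_mixture e s"
    by (rule real_distribution_gaussian_mixture[OF e s])
  let ?P = "iid n (gaussian_mixture e s)"
  interpret P: prob_space ?P by (rule M.prob_space_iid)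
  define t where "t = Psi x"
  define p where "p = M.prob {- x..x}"
  define v where "v = real n * (t * (1 - t))"
  define D where "D = real n * \<bar>p - t\<bar>"
  have t: "0 < t" "t < 1" using Psi_pos[OF x] Psi_less_1[of x] x by (auto simp: t_def)
  have v: "0 < v" using t n by (simp add: v_def)
  have "p = t + e * (Psi (x / s) - Psi x)"
    using measure_gaussian_mixture_interval[OF e s, of x] x by (simp add: p_def t_def)
  then have dp: "d \<le> \<bar>p - t\<bar>" using d e by (simp add: abs_mult)
  have D1: "8 * h\<^sup>2 \<le> D"
    using shift(1) mult_left_mono[OF dp, of "real n"] by (simp add: D_def)
  have D2: "8 * (h\<^sup>2 * v) \<le> D\<^sup>2"
  proof -
    have "real n * (8 * h\<^sup>2 * (t * (1 - t))) \<le> real n * (real n * d\<^sup>2)"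
      using shift(2) by (intro mult_left_mono) (auto simp: t_def)
    also have "\<dots> = (real n * d)\<^sup>2" by (simp add: power2_eq_square)
    also have "\<dots> \<le> D\<^sup>2" unfolding D_def using dp d by (intro power_mono mult_left_mono) auto
    finally show ?thesis by (simp add: v_def mult_ac)
  qed
  have D0: "0 \<le> D" by (simp add: D_def)
  have half_D: "h * sqrt u \<le> D / 2" if "0 \<le> u" "4 * (h\<^sup>2 * u) \<le> D\<^sup>2" for u
  proof (rule power2_le_imp_le)
    show "(h * sqrt u)\<^sup>2 \<le> (D / 2)\<^sup>2" using that by (simp add: power_mult_distrib power_divide)
  qed (use D0 in simp)
  \<comment> \<open>Half of the shift exceeds \<open>h\<close> times the scale of the concentration bound at the true law.\<close>
  have tight: "h * max 1 (sqrt (real n * (p * (1 - p)))) \<le> D / 2"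
  proof -
    have p: "0 \<le> p" "p \<le> 1" by (auto simp: p_def)
    have "real n * (p * (1 - p)) \<le> real n * (t * (1 - t) + \<bar>p - t\<bar>)"
      using t p by (intro mult_left_mono bernoulli_variance_lipschitz) auto
    also have "\<dots> = v + D" by (simp add: v_def D_def distrib_left)
    finally have "4 * (h\<^sup>2 * (real n * (p * (1 - p)))) \<le> 4 * (h\<^sup>2 * (v + D))"
      by (intro mult_left_mono) auto
    moreover have "8 * h\<^sup>2 * D \<le> D * D" using D1 D0 by (intro mult_right_mono)
    ultimately have "4 * (h\<^sup>2 * (real n * (p * (1 - p)))) \<le> D\<^sup>2"
      using D2 by (simp add: power2_eq_square algebra_simps)
    then have "h * sqrt (real n * (p * (1 - p))) \<le> D / 2" using p by (intro half_D) auto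
    moreover have "h \<le> D / 2"
    proof -
      have "h * 1 \<le> h * h" using h by (intro mult_left_mono) auto
      then show ?thesis using D1 h unfolding power2_eq_square by linarith
    qed
    ultimately show ?thesis by (simp add: max_def)
  qed
  have "{X \<in> space ?P. \<not> ereal h \<le> hc_stat n X} \<subseteq> {X \<in> space ?P.
      h * max 1 (sqrt (real n * (p * (1 - p)))) \<le> \<bar>hits n {- x..x} X - real n * p\<bar>}"
  proof clarify
    fix X assume "\<not> ereal h \<le> hc_stat n X"
    moreover have "ereal (sqrt (real n) * \<bar>emp_cdf n X x - Psi x\<bar> / sqrt (Psi x * (1 - Psi x))) \<le> hc_stat n X"
      unfolding hc_stat_def using x by (intro SUP_upper) auto
    ultimately have "ereal (sqrt (real n) * \<bar>emp_cdf n X x - Psi x\<bar> / sqrt (Psi x * (1 - Psi x))) < ereal h"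
      by (meson not_le le_less_trans)
    then have "\<bar>hits n {- x..x} X - real n * t\<bar> / sqrt v \<le> h"
      using hc_term_eq[OF n] by (simp add: t_def v_def)
    then have "\<bar>hits n {- x..x} X - real n * t\<bar> \<le> h * sqrt v" using v by (simp add: divide_le_eq)
    also have "\<dots> \<le> D / 2"
    proof (rule half_D)
      have "0 \<le> h\<^sup>2 * v" using v by simp
      then show "4 * (h\<^sup>2 * v) \<le> D\<^sup>2" using D2 by linarith
    qed (use v in simp)
    finally have "\<bar>hits n {- x..x} X - real n * t\<bar> \<le> D / 2" .
    moreover have "D = \<bar>real n * p - real n * t\<bar>"
      by (simp add: D_def abs_mult flip: right_diff_distrib)
    ultimately have "D / 2 \<le> \<bar>hits n {- x..x} X - real n * p\<bar>" by linarith
    with tight show "h * max 1 (sqrt (real n * (p * (1 - p)))) \<le> \<bar>hits n {- x..x} X - real n * p\<bar>"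
      by linarith
  qed
  moreover have [measurable]: "hits n {- x..x} \<in> borel_measurable ?P"
    by (intro M.hits_measurable) simp
  ultimately have "P.prob {X \<in> space ?P. \<not> ereal h \<le> hc_stat n X} \<le> P.prob {X \<in> space ?P.
      h * max 1 (sqrt (real n * (p * (1 - p)))) \<le> \<bar>hits n {- x..x} X - real n * p\<bar>}"
    by (intro P.finite_measure_mono) auto
  also have "\<dots> \<le> 2 * exp (1 - h)"
    unfolding p_def by (intro M.hits_concentration) simp
  finally show ?thesis .
qed

section \<open>A criterion for asymptotic power\<close>

lemma eventually_regime:
  assumes "0 < \<beta>"
  shows "\<forall>\<^sub>F n in sequentially. n \<in> regime \<beta>"
proof -
  have "\<forall>\<^sub>F n in sequentially. real n powr (- \<beta>) < 1 / 2" using assms by real_asymp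
  then show ?thesis
    using eventually_ge_at_top[of 1] by eventually_elim (simp add: regime_def eps_def)
qed

text \<open>Any choice works that grows faster than the \<open>(ln n) powr (3 / 2)\<close> to which the statistic is
  confined under the null hypothesis, and slower than every positive power of \<open>n\<close>.\<close>

definition critical_value :: "nat \<Rightarrow> real"
  where "critical_value n = (ln (real n))\<^sup>2"

text \<open>With \<open>L = 3 * ln n\<close> the \<open>n\<close> grid points fail with total probability of order \<open>1 / n\<^sup>2\<close>, and
  \<open>\<delta> = 1 / ln n\<close> tends to \<open>0\<close> slowly enough that the bound on the statistic is only of order
  \<open>(ln n) powr (3 / 2)\<close>.\<close>

lemma hc_type_I_tendsto_0:
  "(\<lambda>n. measure (iid n (gaussian 1)) {X \<in> space (iid n (gaussian 1)). ereal (critical_value n) \<le> hc_stat n X})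
    \<longlonglongrightarrow> 0"
proof (rule tendsto_sandwich[OF _ _ tendsto_const])
  let ?L = "\<lambda>n::nat. 3 * ln (real n)" and ?\<delta> = "\<lambda>n::nat. 1 / ln (real n)"
  have "\<forall>\<^sub>F n::nat in sequentially. (3 * ln (real n) + 1) * sqrt (1 + 2 / (1 / ln (real n))) < (ln (real n))\<^sup>2"
    by real_asymp
  moreover have "\<forall>\<^sub>F n::nat in sequentially. 1 \<le> ln (real n)" by real_asymp
  ultimately show "\<forall>\<^sub>F n in sequentially.
      measure (iid n (gaussian 1)) {X \<in> space (iid n (gaussian 1)). ereal (critical_value n) \<le> hc_stat n X}
      \<le> real n * (2 * exp (1 - ?L n)) + 2 * ?\<delta> n"
    using eventually_ge_at_top[of 2]
    by eventually_elim (intro hc_type_I_le, auto simp: critical_value_def)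
  show "(\<lambda>n. real n * (2 * exp (1 - ?L n)) + 2 * ?\<delta> n) \<longlonglongrightarrow> 0" by real_asymp
qed (simp add: always_eventually)

text \<open>The test is powerful once some threshold \<open>x n\<close> has a mean shift, at least \<open>n * d n\<close>, of order
  \<open>(ln n) ^ 4\<close> or more that exceeds the null standard deviation, at most \<open>sqrt (n * w n)\<close>, by a factor
  of order \<open>(ln n)\<^sup>2\<close> or more. Bounds \<open>d\<close> and \<open>w\<close> in place of the exact values let the
  applications work with powers of \<open>n\<close>.\<close>

lemma hc_powerfulI:
  fixes x d w :: "nat \<Rightarrow> real"
  assumes \<beta>: "0 < \<beta>"
    and pos: "\<forall>\<^sub>F n in sequentially. 0 < \<sigma> n \<and> 0 < x n"
    and d: "\<forall>\<^sub>F n in sequentially. 0 \<le> d n \<and> d n \<le> eps \<beta> n * \<bar>Psi (x n / \<sigma> n) - Psi (x n)\<bar>"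
    and w: "\<forall>\<^sub>F n in sequentially. Psi (x n) * (1 - Psi (x n)) \<le> w n"
    and shift: "\<forall>\<^sub>F n in sequentially. 8 * (critical_value n)\<^sup>2 \<le> real n * d n"
      "\<forall>\<^sub>F n in sequentially. 8 * (critical_value n)\<^sup>2 * w n \<le> real n * (d n)\<^sup>2"
  shows "hc_powerful critical_value \<beta> \<sigma>"
proof -
  let ?P = "\<lambda>n. iid n (gaussian_mixture (eps \<beta> n) (\<sigma> n))"
  have "(\<lambda>n. measure (?P n) {X \<in> space (?P n). \<not> ereal (critical_value n) \<le> hc_stat n X}) \<longlonglongrightarrow> 0"
  proof (rule tendsto_sandwich[OF _ _ tendsto_const])
    have "\<forall>\<^sub>F n in sequentially. 1 \<le> critical_value n" unfolding critical_value_def by real_asymp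
    then show "\<forall>\<^sub>F n in sequentially.
        measure (?P n) {X \<in> space (?P n). \<not> ereal (critical_value n) \<le> hc_stat n X} \<le> 2 * exp (1 - critical_value n)"
      using eventually_regime[OF \<beta>] pos d w shift
    proof eventually_elim
      case (elim n)
      have "8 * (critical_value n)\<^sup>2 * (Psi (x n) * (1 - Psi (x n))) \<le> 8 * (critical_value n)\<^sup>2 * w n"
        using elim by (intro mult_left_mono) auto
      also have "\<dots> \<le> real n * (d n)\<^sup>2" using elim by simp
      finally have "8 * (critical_value n)\<^sup>2 * (Psi (x n) * (1 - Psi (x n))) \<le> real n * (d n)\<^sup>2" .
      from hc_type_II_le[OF _ _ _ _ _ _ _ _ _ this] show ?case
        using elim by (simp add: regime_def eps_def)
    qed
    show "(\<lambda>n. 2 * exp (1 - critical_value n)) \<longlonglongrightarrow> 0" unfolding critical_value_def by real_asymp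
  qed (simp add: always_eventually)
  from tendsto_add[OF hc_type_I_tendsto_0 this] show ?thesis
    by (simp add: hc_powerful_def hc_risk_def Let_def)
qed

section \<open>The detectable regimes\<close>

lemma Psi_variance_le_1: "0 \<le> x \<Longrightarrow> Psi x * (1 - Psi x) \<le> 1"
  using Psi_nonneg[of x] Psi_le_1[of x] by (intro mult_le_one) auto

text \<open>Observations from the narrow component pile up near \<open>0\<close>. At the threshold \<open>x = \<sigma> n\<close> a fixed
  fraction of them is counted, so the shift is of order \<open>n powr (1 - \<beta>)\<close>, while the null variance is
  at most \<open>n * Psi (\<sigma> n) \<le> n powr (1 - \<gamma>)\<close>. The squared shift wins precisely when
  \<open>2 * \<beta> - 1 < \<gamma>\<close>.\<close>

lemma hc_powerful_shrinking:
  assumes \<beta>: "0 < \<beta>" "\<beta> < 1" and \<gamma>: "0 < \<gamma>" "2 * \<beta> - 1 < \<gamma>"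
    and \<sigma>: "\<forall>\<^sub>F n in sequentially. \<sigma> n = real n powr (- \<gamma>)"
  shows "hc_powerful critical_value \<beta> \<sigma>"
proof -
  define c where "c = Psi 1 - Psi (1 / 2)"
  have c: "0 < c" using Psi_strict_mono[of "1 / 2" 1] by (simp add: c_def)
  have pos: "\<forall>\<^sub>F n in sequentially. 0 < \<sigma> n"
    using \<sigma> eventually_gt_at_top[of 0] by eventually_elim simp
  have "\<forall>\<^sub>F n::nat in sequentially. real n powr (- \<gamma>) \<le> 1 / 2" using \<gamma> by real_asymp
  then have small: "\<forall>\<^sub>F n in sequentially. \<sigma> n \<le> 1 / 2" using \<sigma> by eventually_elim simp
  show ?thesis
  proof (rule hc_powerfulI[where x=\<sigma> and d="\<lambda>n. c * real n powr (- \<beta>)" and w="\<lambda>n. real n powr (- \<gamma>)"])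
    show "\<forall>\<^sub>F n in sequentially. 0 < \<sigma> n \<and> 0 < \<sigma> n" using pos by simp
    show "\<forall>\<^sub>F n in sequentially. 0 \<le> c * real n powr (- \<beta>) \<and>
        c * real n powr (- \<beta>) \<le> eps \<beta> n * \<bar>Psi (\<sigma> n / \<sigma> n) - Psi (\<sigma> n)\<bar>"
      using pos small
    proof eventually_elim
      case (elim n)
      have "c \<le> \<bar>Psi 1 - Psi (\<sigma> n)\<bar>" using Psi_mono[OF elim(2)] by (simp add: c_def)
      then have "c * real n powr (- \<beta>) \<le> \<bar>Psi 1 - Psi (\<sigma> n)\<bar> * real n powr (- \<beta>)"
        by (intro mult_right_mono) auto
      then show ?case using elim c by (simp add: eps_def mult.commute)
    qed
    show "\<forall>\<^sub>F n in sequentially. Psi (\<sigma> n) * (1 - Psi (\<sigma> n)) \<le> real n powr (- \<gamma>)"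
      using pos \<sigma>
    proof eventually_elim
      case (elim n)
      have "Psi (\<sigma> n) * (1 - Psi (\<sigma> n)) \<le> \<sigma> n * 1"
        using elim Psi_nonneg[of "\<sigma> n"] Psi_le_1[of "\<sigma> n"] Psi_le_self[of "\<sigma> n"] by (intro mult_mono) auto
      then show ?case using elim by simp
    qed
    show "\<forall>\<^sub>F n in sequentially. 8 * (critical_value n)\<^sup>2 \<le> real n * (c * real n powr (- \<beta>))"
      unfolding critical_value_def using \<beta> c by real_asymp
    show "\<forall>\<^sub>F n in sequentially. 8 * (critical_value n)\<^sup>2 * real n powr (- \<gamma>) \<le> real n * (c * real n powr (- \<beta>))\<^sup>2"
      unfolding critical_value_def using \<beta> c \<gamma> by real_asymp
  qed (rule \<beta>)
qed

text \<open>For \<open>\<beta> < 1 / 2\<close> the fixed threshold \<open>x = 1\<close> suffices: the null standard deviation is of order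
  \<open>sqrt n\<close>, and the shift is at least of order \<open>n powr (1 - \<beta> - \<gamma>)\<close>.\<close>

lemma hc_powerful_dense:
  assumes \<beta>: "0 < \<beta>" and \<gamma>: "0 \<le> \<gamma>" "\<gamma> < 1 / 2 - \<beta>" and c: "0 < c"
    and pos: "\<forall>\<^sub>F n in sequentially. 0 < \<sigma> n"
    and diff: "\<forall>\<^sub>F n in sequentially. c * real n powr (- \<gamma>) \<le> \<bar>Psi (1 / \<sigma> n) - Psi 1\<bar>"
  shows "hc_powerful critical_value \<beta> \<sigma>"
proof (rule hc_powerfulI[where x="\<lambda>_. 1" and d="\<lambda>n. c * real n powr (- \<beta> - \<gamma>)" and w="\<lambda>_. 1"])
  show "\<forall>\<^sub>F n in sequentially. 0 < \<sigma> n \<and> 0 < (1 :: real)" using pos by simp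
  show "\<forall>\<^sub>F n in sequentially. 0 \<le> c * real n powr (- \<beta> - \<gamma>) \<and>
      c * real n powr (- \<beta> - \<gamma>) \<le> eps \<beta> n * \<bar>Psi (1 / \<sigma> n) - Psi 1\<bar>"
    using diff eventually_gt_at_top[of 0]
  proof eventually_elim
    case (elim n)
    have "c * real n powr (- \<beta> - \<gamma>) = eps \<beta> n * (c * real n powr (- \<gamma>))"
      by (simp add: eps_def powr_diff powr_minus field_simps)
    also have "\<dots> \<le> eps \<beta> n * \<bar>Psi (1 / \<sigma> n) - Psi 1\<bar>"
      using elim by (intro mult_left_mono) (auto simp: eps_def)
    finally show ?case using c by simp
  qed
  show "\<forall>\<^sub>F n in sequentially. Psi 1 * (1 - Psi 1) \<le> 1"
    using Psi_variance_le_1[of 1] by simp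
  show "\<forall>\<^sub>F n in sequentially. 8 * (critical_value n)\<^sup>2 \<le> real n * (c * real n powr (- \<beta> - \<gamma>))"
    unfolding critical_value_def using \<beta> c \<gamma> by real_asymp
  show "\<forall>\<^sub>F n in sequentially. 8 * (critical_value n)\<^sup>2 * 1 \<le> real n * (c * real n powr (- \<beta> - \<gamma>))\<^sup>2"
    unfolding critical_value_def using \<beta> c \<gamma> by real_asymp
qed (rule \<beta>)

lemma Psi_inverse_diff_ge:
  assumes "1 / 2 \<le> s" "s \<le> 2"
  shows "std_normal_density 2 * \<bar>s - 1\<bar> \<le> \<bar>Psi (1 / s) - Psi 1\<bar>"
proof -
  let ?u = "min 1 (1 / s)" and ?v = "max 1 (1 / s)"
  have s: "0 < s" using assms by simp
  have "1 / s - 1 = (1 - s) / s" using s by (simp add: diff_divide_distrib)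
  then have "\<bar>1 / s - 1\<bar> = \<bar>s - 1\<bar> / s" using s by (simp add: abs_minus_commute)
  then have gap: "\<bar>s - 1\<bar> \<le> 2 * (?v - ?u)"
    using assms s mult_left_mono[of s 2 "\<bar>s - 1\<bar>"] by (auto simp: max_def min_def abs_if field_simps split: if_splits)
  have "?v \<le> 2" using assms s by (simp add: field_simps)
  then have "std_normal_density 2 \<le> std_normal_density ?v" by (intro std_normal_density_antimono) auto
  then have "std_normal_density 2 * \<bar>s - 1\<bar> \<le> std_normal_density ?v * (2 * (?v - ?u))"
    using gap by (intro mult_mono) auto
  also have "\<dots> = 2 * std_normal_density ?v * (?v - ?u)" by (simp only: mult_ac)
  also have "\<dots> \<le> Psi ?v - Psi ?u" by (rule Psi_diff_ge) (use s in auto)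
  also have "\<dots> \<le> \<bar>Psi (1 / s) - Psi 1\<bar>" by (auto simp: max_def min_def)
  finally show ?thesis .
qed

lemma hc_powerful_near_1:
  assumes \<beta>: "0 < \<beta>" and \<gamma>: "0 < \<gamma>" "\<gamma> < 1 / 2 - \<beta>"
    and \<sigma>: "\<forall>\<^sub>F n in sequentially. \<bar>\<sigma> n - 1\<bar> = real n powr (- \<gamma>)"
  shows "hc_powerful critical_value \<beta> \<sigma>"
proof -
  have "\<forall>\<^sub>F n::nat in sequentially. real n powr (- \<gamma>) \<le> 1 / 2" using \<gamma> by real_asymp
  then have near: "\<forall>\<^sub>F n in sequentially. 1 / 2 \<le> \<sigma> n \<and> \<sigma> n \<le> 2"
    using \<sigma> by eventually_elim linarith
  show ?thesis
  proof (rule hc_powerful_dense[of \<beta> \<gamma> "std_normal_density 2"])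
    show "\<forall>\<^sub>F n in sequentially. 0 < \<sigma> n" using near by eventually_elim simp
    show "\<forall>\<^sub>F n in sequentially. std_normal_density 2 * real n powr (- \<gamma>) \<le> \<bar>Psi (1 / \<sigma> n) - Psi 1\<bar>"
      using near \<sigma>
    proof eventually_elim
      case (elim n)
      then show ?case using Psi_inverse_diff_ge[of "\<sigma> n"] by simp
    qed
  qed (use assms in \<open>auto simp: normal_density_pos\<close>)
qed

lemma hc_powerful_fixed_dense:
  assumes \<beta>: "0 < \<beta>" "\<beta> < 1 / 2" and s: "0 < s" "s \<noteq> 1"
    and \<sigma>: "\<forall>\<^sub>F n in sequentially. \<sigma> n = s"
  shows "hc_powerful critical_value \<beta> \<sigma>"
proof (rule hc_powerful_dense[of \<beta> 0 "\<bar>Psi (1 / s) - Psi 1\<bar>"])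
  have "1 / s \<noteq> 1" using s by simp
  then have "Psi (1 / s) \<noteq> Psi 1"
    using Psi_less_iff[of "1 / s" 1] Psi_less_iff[of 1 "1 / s"] s by (metis less_irrefl linorder_neqE_linordered_idom less_imp_le zero_le_one zero_less_divide_1_iff)
  then show "0 < \<bar>Psi (1 / s) - Psi 1\<bar>" by simp
  show "\<forall>\<^sub>F n in sequentially. 0 < \<sigma> n" using \<sigma> by eventually_elim (use s in simp)
  show "\<forall>\<^sub>F n in sequentially. \<bar>Psi (1 / s) - Psi 1\<bar> * real n powr (- 0) \<le> \<bar>Psi (1 / \<sigma> n) - Psi 1\<bar>"
    using \<sigma> eventually_gt_at_top[of 0] by eventually_elim simp
qed (use \<beta> in auto)

text \<open>For a wide component the information sits in the tail. At \<open>x = sqrt (2 * r * ln n)\<close> the null tail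
  is about \<open>n powr (- r)\<close> and the tail of the wide component about \<open>n powr (- r / s\<^sup>2)\<close>. The shift
  tends to infinity if \<open>\<beta> + r / s\<^sup>2 < 1\<close>, and it dominates the null standard deviation if
  \<open>2 * \<beta> + 2 * r / s\<^sup>2 < 1 + r\<close>. The largest \<open>r\<close> allowed by the first condition is
  \<open>a = s\<^sup>2 * (1 - \<beta>)\<close>, at which the second one reads \<open>a > 1\<close>: this is the hypothesis on \<open>s\<close>. Halfway
  between \<open>1\<close> and \<open>a\<close> both conditions hold strictly.\<close>

lemma hc_powerful_fixed_sparse:
  assumes \<beta>: "0 < \<beta>" "\<beta> < 1" and s: "1 / sqrt (1 - \<beta>) < s"
    and \<sigma>: "\<forall>\<^sub>F n in sequentially. \<sigma> n = s"
  shows "hc_powerful critical_value \<beta> \<sigma>"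
proof -
  have "0 < 1 / sqrt (1 - \<beta>)" using \<beta> by simp
  then have s0: "0 < s" using s by linarith
  define a where "a = s\<^sup>2 * (1 - \<beta>)"
  have a: "1 < a"
  proof -
    have "1 < s * sqrt (1 - \<beta>)" using s \<beta> by (simp add: field_simps)
    then have "1 < (s * sqrt (1 - \<beta>))\<^sup>2" by (simp add: one_less_power)
    then show ?thesis using \<beta> by (simp add: a_def power_mult_distrib)
  qed
  define r where "r = (a + 1) / 2"
  have r: "1 < r" using a by (simp add: r_def)
  have s2: "s\<^sup>2 = a / (1 - \<beta>)" using \<beta> by (simp add: a_def)
  have rs: "r / s\<^sup>2 = (1 - \<beta>) / 2 + (1 - \<beta>) / a / 2"
    using a \<beta> unfolding s2 r_def by (simp add: field_simps)
  have qa: "(1 - \<beta>) / a < 1 - \<beta>"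
    using a \<beta> divide_strict_left_mono[of 1 a "1 - \<beta>"] by simp
  have "u < 1 - \<beta>" "u < (1 - 2 * \<beta> + r) / 2" "u < r"
    if "u = (1 - \<beta>) / 2 + q / 2" "q < 1 - \<beta>" for u q
    using that r \<beta> by (auto simp: field_simps)
  from this[OF rs qa] have "r / s\<^sup>2 < min (1 - \<beta>) (min ((1 - 2 * \<beta> + r) / 2) r)" by simp
  \<comment> \<open>The tail of the wide component will be bounded below by \<open>n powr (- b)\<close>; choosing \<open>b\<close> above
    \<open>r / s\<^sup>2\<close> absorbs the subpolynomial loss in the Gaussian tail bound.\<close>
  then obtain b where b: "r / s\<^sup>2 < b" "b < 1 - \<beta>" "b < (1 - 2 * \<beta> + r) / 2" "b < r"
    using dense by (metis min_less_iff_conj)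
  define K where "K = sqrt (2 * r) / s"
  have K: "0 < K" "K\<^sup>2 / 2 < b"
    using r s0 b(1) by (auto simp: K_def power_divide)
  define x where "x n = sqrt (2 * r * ln (real n))" for n :: nat
  define c where "c = 2 * (1 / sqrt (2 * pi))"
  have c: "0 < c" "c \<le> 1"
  proof -
    have "2 \<le> sqrt (2 * pi)" using pi_gt3 by (intro real_le_rsqrt) simp
    then show "0 < c" "c \<le> 1" by (auto simp: c_def field_simps)
  qed
  have ln_ge_1: "\<forall>\<^sub>F n::nat in sequentially. 1 \<le> ln (real n)" by real_asymp
  have null_tail: "\<forall>\<^sub>F n in sequentially. 1 - Psi (x n) \<le> real n powr (- r)"
    using ln_ge_1 eventually_gt_at_top[of 0]
  proof eventually_elim
    case (elim n)
    have "1 * 1 \<le> 2 * r * ln (real n)" using elim r by (intro mult_mono) auto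
    then have "1 \<le> x n" by (simp add: x_def)
    then have "1 - Psi (x n) \<le> c * exp (- (x n)\<^sup>2 / 2)"
      using Psi_upper_tail_le[of "x n"] by (simp add: std_normal_density_def c_def)
    also have "\<dots> \<le> 1 * exp (- (x n)\<^sup>2 / 2)" using c by (intro mult_right_mono) auto
    also have "\<dots> = real n powr (- r)"
      using elim r by (simp add: x_def powr_def)
    finally show ?case .
  qed
  have "\<forall>\<^sub>F n::nat in sequentially. 2 * real n powr (- b) \<le> c * exp (- (K * sqrt (ln (real n)) + 1)\<^sup>2 / 2)"
    using K c by real_asymp
  then have mixture_tail: "\<forall>\<^sub>F n in sequentially. 2 * real n powr (- b) \<le> 1 - Psi (x n / s)"
    using ln_ge_1
  proof eventually_elim
    case (elim n)
    have "x n / s = K * sqrt (ln (real n))" by (simp add: x_def K_def real_sqrt_mult)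
    moreover have "0 \<le> K * sqrt (ln (real n))" using K elim by simp
    ultimately have "c * exp (- (K * sqrt (ln (real n)) + 1)\<^sup>2 / 2) \<le> 1 - Psi (x n / s)"
      using Psi_upper_tail_ge[of "x n / s"] by (simp add: std_normal_density_def c_def)
    then show ?case using elim by linarith
  qed
  have br: "\<forall>\<^sub>F n::nat in sequentially. real n powr (- r) \<le> real n powr (- b)"
    using b by real_asymp
  show ?thesis
  proof (rule hc_powerfulI[where x=x and d="\<lambda>n. real n powr (- \<beta> - b)" and w="\<lambda>n. real n powr (- r)"])
    show "\<forall>\<^sub>F n in sequentially. 0 < \<sigma> n \<and> 0 < x n"
      using \<sigma> ln_ge_1 by eventually_elim (use r s0 in \<open>simp add: x_def\<close>)
    show "\<forall>\<^sub>F n in sequentially. 0 \<le> real n powr (- \<beta> - b) \<and>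
        real n powr (- \<beta> - b) \<le> eps \<beta> n * \<bar>Psi (x n / \<sigma> n) - Psi (x n)\<bar>"
      using \<sigma> null_tail mixture_tail br eventually_gt_at_top[of 0]
    proof eventually_elim
      case (elim n)
      then have "real n powr (- b) \<le> \<bar>Psi (x n / \<sigma> n) - Psi (x n)\<bar>" by simp
      then have "eps \<beta> n * real n powr (- b) \<le> eps \<beta> n * \<bar>Psi (x n / \<sigma> n) - Psi (x n)\<bar>"
        by (intro mult_left_mono) (auto simp: eps_def)
      moreover have "real n powr (- \<beta> - b) = eps \<beta> n * real n powr (- b)"
        by (simp add: eps_def powr_diff powr_minus field_simps)
      ultimately show ?case using powr_ge_zero[of "real n" "- \<beta> - b"] by linarith
    qed
    show "\<forall>\<^sub>F n in sequentially. Psi (x n) * (1 - Psi (x n)) \<le> real n powr (- r)"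
      using null_tail
    proof eventually_elim
      case (elim n)
      have "Psi (x n) * (1 - Psi (x n)) \<le> 1 * (1 - Psi (x n))"
        using Psi_le_1[of "x n"] by (intro mult_right_mono) auto
      then show ?case using elim by simp
    qed
    show "\<forall>\<^sub>F n in sequentially. 8 * (critical_value n)\<^sup>2 \<le> real n * real n powr (- \<beta> - b)"
      unfolding critical_value_def using b(2) by real_asymp
    show "\<forall>\<^sub>F n in sequentially. 8 * (critical_value n)\<^sup>2 * real n powr (- r) \<le> real n * (real n powr (- \<beta> - b))\<^sup>2"
      unfolding critical_value_def using b(3) by real_asymp
  qed (rule \<beta>)
qed

theorem proposition3:
  "\<exists>h :: nat \<Rightarrow> real. \<forall>(\<beta> :: real) (\<sigma> :: nat \<Rightarrow> real).
     0 < \<beta> \<and> \<beta> < 1 \<and> (\<forall>n\<in>regime \<beta>. 0 < \<sigma> n) \<longrightarrow>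
       (\<forall>\<gamma>. 0 < \<gamma> \<and> 2 * \<beta> - 1 < \<gamma> \<and> (\<forall>n\<in>regime \<beta>. \<sigma> n = real n powr (- \<gamma>))
          \<longrightarrow> hc_powerful h \<beta> \<sigma>) \<and>
       (\<forall>\<gamma>. 0 < \<gamma> \<and> \<gamma> < 1 / 2 - \<beta> \<and> (\<forall>n\<in>regime \<beta>. \<bar>\<sigma> n - 1\<bar> = real n powr (- \<gamma>))
          \<longrightarrow> hc_powerful h \<beta> \<sigma>) \<and>
       (\<forall>s. 1 / sqrt (1 - \<beta>) < s \<and> (\<forall>n\<in>regime \<beta>. \<sigma> n = s)
          \<longrightarrow> hc_powerful h \<beta> \<sigma>) \<and>
       (\<forall>s. \<beta> < 1 / 2 \<and> s \<noteq> 1 \<and> (\<forall>n\<in>regime \<beta>. \<sigma> n = s)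
          \<longrightarrow> hc_powerful h \<beta> \<sigma>)"
proof (intro exI[of _ critical_value] allI impI conjI)
  fix \<beta> :: real and \<sigma> :: "nat \<Rightarrow> real"
  assume "0 < \<beta> \<and> \<beta> < 1 \<and> (\<forall>n\<in>regime \<beta>. 0 < \<sigma> n)"
  then have \<beta>: "0 < \<beta>" "\<beta> < 1" and pos: "\<forall>n\<in>regime \<beta>. 0 < \<sigma> n" by auto
  have ev: "\<forall>\<^sub>F n in sequentially. P n" if "\<forall>n\<in>regime \<beta>. P n" for P
    using eventually_regime[OF \<beta>(1)] by eventually_elim (use that in blast)
  {
    fix \<gamma> assume "0 < \<gamma> \<and> 2 * \<beta> - 1 < \<gamma> \<and> (\<forall>n\<in>regime \<beta>. \<sigma> n = real n powr (- \<gamma>))"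
    then show "hc_powerful critical_value \<beta> \<sigma>" using \<beta> ev by (intro hc_powerful_shrinking[of \<beta> \<gamma>]) auto
  next
    fix \<gamma> assume "0 < \<gamma> \<and> \<gamma> < 1 / 2 - \<beta> \<and> (\<forall>n\<in>regime \<beta>. \<bar>\<sigma> n - 1\<bar> = real n powr (- \<gamma>))"
    then show "hc_powerful critical_value \<beta> \<sigma>" using \<beta> ev by (intro hc_powerful_near_1[of \<beta> \<gamma>]) auto
  next
    fix s assume "1 / sqrt (1 - \<beta>) < s \<and> (\<forall>n\<in>regime \<beta>. \<sigma> n = s)"
    then show "hc_powerful critical_value \<beta> \<sigma>" using \<beta> ev by (intro hc_powerful_fixed_sparse[of \<beta> s]) auto
  next
    fix s assume s: "\<beta> < 1 / 2 \<and> s \<noteq> 1 \<and> (\<forall>n\<in>regime \<beta>. \<sigma> n = s)"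
    \<comment> \<open>The value \<open>s\<close> is known to be positive only through an \<open>n\<close> at which \<open>\<sigma>\<close> attains it.\<close>
    obtain n where "n \<in> regime \<beta>"
      using eventually_happens'[OF sequentially_bot eventually_regime[OF \<beta>(1)]] by blast
    then have "0 < s" using pos s by metis
    then show "hc_powerful critical_value \<beta> \<sigma>"
      using s \<beta> ev by (intro hc_powerful_fixed_dense[of \<beta> s]) auto
  }
qed

end
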